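(* Let $d\ge 2$, let $\mathbf{T}^d:=\mathrm{conv}\{\mathbf{t}_1,\mathbf{t}_2,\dots,\mathbf{t}_{d+1}\}$ be a regular $d$-simplex of edge length $2$ in $\mathbb{E}^d$, and let $0\le\lambda<\sqrt{\frac{2d}{d+1}}-1$. Then $$\bar{\delta}_d(\lambda)\le\bar{\sigma}_d(\lambda):=\frac{\mathrm{vol}_d\left(\mathbf{T}^d\cap\bigcup_{i=1}^{d+1}\left(\mathbf{t}_i+(1+\lambda)\mathbf{B}^d\right)\right)}{\mathrm{vol}_d(\mathbf{T}^d)}<1.$$
   Context: $\mathbb{E}^d$ is $d$-dimensional Euclidean space, $\mathbf{B}^d$ its closed unit ball centered at the origin, $\mathrm{vol}_d$ the $d$-dimensional volume. An infinite packing of unit balls is a family $\mathcal{P}=\{\mathbf{c}_i+\mathbf{B}^d : i=1,2,\dots\}$ with $\|\mathbf{c}_j-\mathbf{c}_k\|\ge 2$ for all $1\le j<k$. For $\lambda\ge 0$ let $\mathbf{P}_\lambda:=\bigcup_{i=1}^{+\infty}(\mathbf{c}_i+(1+\lambda)\mathbf{B}^d)$, and let $$\bar{\delta}_d(\mathbf{P}_\lambda):=\limsup_{R\to+\infty}\frac{\mathrm{vol}_d(\mathbf{P}_\lambda\cap R\mathbf{B}^d)}{\mathrm{vol}_d(R\mathbf{B}^d)},\qquad \bar{\delta}_d(\lambda):=\sup_{\mathcal{P}}\bar{\delta}_d(\mathbf{P}_\lambda),$$ the supremum being over all infinite packings $\mathcal{P}$ of unit balls in $\mathbb{E}^d$.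 *)

theory Defs
  imports "HOL-Analysis.Analysis"
begin

text \<open>Euclidean d-space is a type \<open>'a::euclidean_space\<close> with \<open>DIM('a) = d\<close>. Infinite families
  are sequences over \<^typ>\<open>nat\<close>, and the \<open>d + 1\<close> vertices of a simplex are
  indexed by \<open>{..DIM('a)}\<close>, so all indices start at 0 rather than 1.\<close>

text \<open>A packing of unit balls is represented by the sequence of its centres.\<close>

definition unit_ball_packing :: "(nat \<Rightarrow> 'a::euclidean_space) \<Rightarrow> bool" where
  "unit_ball_packing c \<longleftrightarrow> (\<forall>j k. j < k \<longrightarrow> norm (c j - c k) \<ge> 2)"

definition soft_packing :: "(nat \<Rightarrow> 'a::euclidean_space) \<Rightarrow> real \<Rightarrow> 'a set" where
  "soft_packing c lam = (\<Union>i. cball (c i) (1 + lam))"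

text \<open>Limit superior and supremum are taken in \<^typ>\<open>ereal\<close>, a complete lattice, so that both
  are meaningful without side conditions.\<close>

definition upper_density :: "'a::euclidean_space set \<Rightarrow> ereal" where
  "upper_density A =
     Limsup at_top (\<lambda>R::real. ereal (measure lebesgue (A \<inter> cball 0 R) / measure lebesgue (cball (0::'a) R)))"

definition max_soft_density :: "'a::euclidean_space itself \<Rightarrow> real \<Rightarrow> ereal" where
  "max_soft_density (_::'a itself) lam =
     (SUP c \<in> {c :: nat \<Rightarrow> 'a. unit_ball_packing c}. upper_density (soft_packing c lam))"

definition regular_simplex_vertices :: "real \<Rightarrow> (nat \<Rightarrow> 'a::euclidean_space) \<Rightarrow> bool" where
  "regular_simplex_vertices l t \<longleftrightarrow>
     \<not> affine_dependent (t ` {..DIM('a)}) \<and>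
     (\<forall>i \<le> DIM('a). \<forall>j \<le> DIM('a). i \<noteq> j \<longrightarrow> dist (t i) (t j) = l)"

definition simplex_soft_density :: "(nat \<Rightarrow> 'a::euclidean_space) \<Rightarrow> real \<Rightarrow> real" where
  "simplex_soft_density t lam =
     measure lebesgue (convex hull (t ` {..DIM('a)}) \<inter> (\<Union>i \<le> DIM('a). cball (t i) (1 + lam)))
       / measure lebesgue (convex hull (t ` {..DIM('a)}))"

end

theory Submission
  imports Defs
begin

text \<open>Rogers' argument. Cut each Voronoi cell into simplices by coning every face, starting with the
  cell, from its point nearest to the centre. A face of codimension \<open>i\<close> is equidistant from \<open>i + 1\<close>
  centres at mutual distance at least 2, so its nearest point \<open>v\<^sub>i\<close> has squared norm at least
  \<open>2i/(i+1)\<close>, and \<open>v\<^sub>i \<bullet> v\<^sub>j \<ge> v\<^sub>i \<bullet> v\<^sub>i\<close> for \<open>i \<le> j\<close>. Coning the faces of the regular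
  simplex from their centroids gives simplices with vertices \<open>w\<^sub>i\<close> (relative to a vertex of the
  regular simplex) for which equality holds throughout. The linear map \<open>w\<^sub>i \<mapsto> v\<^sub>i\<close> therefore does
  not shorten vectors of the simplex, so the part of the simplex within a ball around the centre
  can only become relatively smaller. Summing over all pairs of simplices compares the cell with the
  regular simplex. Intersecting the cells with cubes of side 4 makes them bounded, and the norm bound
  survives because the points of the cube's boundary have squared norm at least 4.\<close>

subsection \<open>Volume of linear images\<close>

lemma emeasure_lborel_translation_vimage:
  fixes A :: "'a::euclidean_space set"
  assumes "A \<in> sets borel"
  shows "emeasure lborel {x. x + c \<in> A} = emeasure lborel A"
proof -
  have "emeasure lborel A = emeasure (distr lborel borel ((+) c)) A"
    by (simp add: lborel_distr_plus)
  also have "\<dots> = emeasure lborel {x. x + c \<in> A}"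
    using assms by (subst emeasure_distr) (auto simp: vimage_def add.commute)
  finally show ?thesis by simp
qed

text \<open>Uniqueness of Haar measure: integrating \<open>1\<^sub>B(y) 1\<^sub>A(g x + y)\<close> in both orders, with \<open>B\<close> the
  unit cube, identifies the scaling factor.\<close>

lemma emeasure_lborel_linear_vimage:
  fixes f g :: "'a::euclidean_space \<Rightarrow> 'a"
  assumes f: "linear f" and g: "linear g" and gf: "\<And>x. g (f x) = x"
    and A: "A \<in> sets borel"
  shows "emeasure lborel {x. g x \<in> A} =
    emeasure lborel {x. - g x \<in> box 0 (One::'a)} * emeasure lborel A"
proof -
  define B :: "'a set" where "B = box 0 One"
  have B: "B \<in> sets borel" by (simp add: B_def)
  have eB: "emeasure lborel B = 1"
    unfolding B_def by (subst emeasure_lborel_box) auto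
  have gm [measurable]: "g \<in> borel_measurable borel"
    using g by (simp add: borel_measurable_continuous_onI linear_continuous_on linear_conv_bounded_linear)
  note [measurable] = A B
  \<comment> \<open>Here \<open>g x + y = g (x + f y)\<close>, so the set is a translate of
    \<open>{x. g x \<in> A}\<close>; the reflected set below is treated in the same way.\<close>
  have Gx: "emeasure lborel {x. g x + y \<in> A} = emeasure lborel {x. g x \<in> A}" for y
  proof -
    have "{x. g x \<in> A} \<in> sets borel" by measurable
    from emeasure_lborel_translation_vimage[OF this, of "f y"] show ?thesis
      by (simp add: linear_add[OF g] gf)
  qed
  have Hx: "emeasure lborel {x. y - g x \<in> B} = emeasure lborel {x. - g x \<in> B}" for y
  proof -
    have "{x. - g x \<in> B} \<in> sets borel" by measurable
    from emeasure_lborel_translation_vimage[OF this, of "- f y"] show ?thesis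
      by (simp add: linear_add[OF g] linear_neg[OF g] linear_diff[OF g] gf)
  qed
  have 1: "(\<integral>\<^sup>+x. indicator A (g x + y) \<partial>lborel) = emeasure lborel {x. g x \<in> A}" for y
  proof -
    have "(\<integral>\<^sup>+x. indicator A (g x + y) \<partial>lborel) = (\<integral>\<^sup>+x. indicator {x. g x + y \<in> A} x \<partial>lborel)"
      by (simp add: indicator_def)
    also have "\<dots> = emeasure lborel {x. g x + y \<in> A}"
      by (subst nn_integral_indicator) measurable
    finally show ?thesis using Gx by simp
  qed
  have 2: "(\<integral>\<^sup>+x. indicator B (y - g x) \<partial>lborel) = emeasure lborel {x. - g x \<in> B}" for y
  proof -
    have "(\<integral>\<^sup>+x. indicator B (y - g x) \<partial>lborel) = (\<integral>\<^sup>+x. indicator {x. y - g x \<in> B} x \<partial>lborel)"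
      by (simp add: indicator_def)
    also have "\<dots> = emeasure lborel {x. y - g x \<in> B}"
      by (subst nn_integral_indicator) measurable
    finally show ?thesis using Hx by simp
  qed
  \<comment> \<open>Substitute \<open>y - g x\<close> for \<open>y\<close>, which moves the
    dependence on \<open>x\<close> from \<open>A\<close> to \<open>B\<close>.\<close>
  have 3: "(\<integral>\<^sup>+y. indicator B y * indicator A (g x + y) \<partial>lborel)
     = (\<integral>\<^sup>+y. indicator B (y - g x) * indicator A y \<partial>lborel)" for x
  proof -
    have "(\<integral>\<^sup>+y. indicator B (y - g x) * indicator A y \<partial>lborel)
      = (\<integral>\<^sup>+y. indicator B (y - g x) * indicator A y \<partial>distr lborel borel ((+) (g x)))"
      by (simp add: lborel_distr_plus)
    also have "\<dots> = (\<integral>\<^sup>+y. indicator B ((g x + y) - g x) * indicator A (g x + y) \<partial>lborel)"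
      by (subst nn_integral_distr) simp_all
    finally show ?thesis by simp
  qed
  have "emeasure lborel {x. g x \<in> A} = (\<integral>\<^sup>+y. indicator B y * emeasure lborel {x. g x \<in> A} \<partial>lborel)"
    by (simp add: nn_integral_multc eB)
  also have "\<dots> = (\<integral>\<^sup>+y. (\<integral>\<^sup>+x. indicator B y * indicator A (g x + y) \<partial>lborel) \<partial>lborel)"
    by (subst nn_integral_cmult) (measurable, simp add: 1)
  also have "\<dots> = (\<integral>\<^sup>+x. (\<integral>\<^sup>+y. indicator B y * indicator A (g x + y) \<partial>lborel) \<partial>lborel)"
    by (rule lborel_pair.Fubini') measurable
  also have "\<dots> = (\<integral>\<^sup>+x. (\<integral>\<^sup>+y. indicator B (y - g x) * indicator A y \<partial>lborel) \<partial>lborel)"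
    by (simp only: 3)
  also have "\<dots> = (\<integral>\<^sup>+y. (\<integral>\<^sup>+x. indicator B (y - g x) * indicator A y \<partial>lborel) \<partial>lborel)"
    by (rule lborel_pair.Fubini') measurable
  also have "\<dots> = (\<integral>\<^sup>+y. emeasure lborel {x. - g x \<in> B} * indicator A y \<partial>lborel)"
    by (subst nn_integral_multc) (measurable, simp add: 2)
  also have "\<dots> = emeasure lborel {x. - g x \<in> B} * emeasure lborel A"
    by (subst nn_integral_cmult) (use A in auto)
  finally show ?thesis by (simp add: B_def)
qed

text \<open>The image under \<open>f\<close> is the preimage under its inverse \<open>g\<close>. The
  value of the factor is irrelevant, because it cancels when two volumes are compared before and
  after the map.\<close>

lemma measure_linear_image_compact:
  fixes f :: "'a::euclidean_space \<Rightarrow> 'a"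
  assumes "linear f" "inj f"
  obtains c where "c \<ge> 0"
    "\<And>S. compact S \<Longrightarrow> measure lebesgue (f ` S) = c * measure lebesgue S"
proof -
  obtain g where g: "linear g" and gf: "\<And>x. g (f x) = x"
    using linear_injective_left_inverse[OF assms] by (metis comp_apply id_apply)
  have fg: "f (g x) = x" for x
    using linear_injective_imp_surjective[OF assms] gf by (metis surjE)
  have im: "f ` S = {x. g x \<in> S}" for S
    using gf fg by (auto simp: image_iff) metis
  \<comment> \<open>\<open>enn2real\<close> is multiplicative even at infinity, so the identity
    passes to real measures without a check that this volume is finite.\<close>
  define c where "c = enn2real (emeasure lborel {x. - g x \<in> box 0 (One::'a)})"
  show ?thesis
  proof
    show "c \<ge> 0" by (simp add: c_def)
    fix S :: "'a set" assume S: "compact S"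
    have "compact (f ` S)"
      using S assms(1) compact_continuous_image linear_continuous_on linear_conv_bounded_linear by blast
    then show "measure lebesgue (f ` S) = c * measure lebesgue S"
      using emeasure_lborel_linear_vimage[OF assms(1) g gf, of S] S
      by (simp add: measure_def c_def im[symmetric] enn2real_mult borel_compact)
  qed
qed

subsection \<open>Dissection of a polytope along its flags\<close>

text \<open>Vertex lists of the simplices obtained by coning each face \<open>G\<close> from the point \<open>p G\<close>; one list
  for each flag of faces of dimensions \<open>n, \<dots>, 0\<close>.\<close>

primrec flag_simplices :: "('a::euclidean_space set \<Rightarrow> 'a) \<Rightarrow> nat \<Rightarrow> 'a set \<Rightarrow> 'a list set" where
  "flag_simplices p 0 F = {[p F]}"
| "flag_simplices p (Suc n) F = (\<Union>G\<in>{G. G facet_of F}. Cons (p F) ` flag_simplices p n G)"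

lemma length_flag_simplex: "L \<in> flag_simplices p n F \<Longrightarrow> length L = Suc n"
  by (induction n arbitrary: F L) auto

lemma hd_flag_simplex: "L \<in> flag_simplices p n F \<Longrightarrow> L ! 0 = p F"
  by (cases n) auto

lemma finite_flag_simplices: "polytope F \<Longrightarrow> finite (flag_simplices p n F)"
  by (induction n arbitrary: F)
     (auto simp: finite_polytope_facets intro!: finite_imageI intro: face_of_polytope_polytope facet_of_imp_face_of)

text \<open>The ray from \<open>v\<close> through a relative interior point \<open>x\<close> leaves
  \<open>F\<close> through a facet, and \<open>x\<close> lies between \<open>v\<close> and the exit
  point. A point of the relative boundary lies in a facet already, and for \<open>x = v\<close> any
  facet will do; the dimension bound provides one.\<close>

lemma cone_over_facet:
  fixes F :: "'a::euclidean_space set"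
  assumes F: "polytope F" and v: "v \<in> F" and x: "x \<in> F" and dim: "aff_dim F \<ge> 1"
  obtains G where "G facet_of F" "x \<in> convex hull (insert v G)"
proof (cases "x = v \<or> x \<notin> rel_interior F")
  case True
  show ?thesis
  proof (cases "x = v")
    case True
    obtain G where "G facet_of F"
      using polytope_facet_exists[OF F] dim by auto
    with True show ?thesis by (intro that[of G]) (auto intro: hull_inc)
  next
    case False
    with True x have "x \<in> \<Union>{G. G facet_of F}"
      using rel_boundary_of_polyhedron[OF polytope_imp_polyhedron[OF F]] by blast
    then show ?thesis using that by (auto intro: hull_inc)
  qed
next
  case False
  \<comment> \<open>The direction \<open>x - v\<close> must stay in the affine hull for the ray to
    meet the relative frontier.\<close>
  have "x + (x - v) \<in> affine hull F"
    using mem_affine[OF affine_affine_hull hull_inc[OF x] hull_inc[OF v], of 2 "-1"]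
    by (simp add: scaleR_2 add_diff_eq)
  then obtain d where d: "0 < d" "x + d *\<^sub>R (x - v) \<in> rel_frontier F"
    using ray_to_rel_frontier[OF polytope_imp_bounded[OF F], of x "x - v"] False by auto
  then obtain G where G: "G facet_of F" "x + d *\<^sub>R (x - v) \<in> G"
    using rel_frontier_of_polyhedron[OF polytope_imp_polyhedron[OF F]] by blast
  have "x = (d / (1 + d)) *\<^sub>R v + (1 / (1 + d)) *\<^sub>R (x + d *\<^sub>R (x - v))"
  proof -
    have "(1 + d) *\<^sub>R x = d *\<^sub>R v + (x + d *\<^sub>R (x - v))"
      by (simp add: algebra_simps)
    then have "(1 / (1 + d)) *\<^sub>R ((1 + d) *\<^sub>R x) = (1 / (1 + d)) *\<^sub>R (d *\<^sub>R v + (x + d *\<^sub>R (x - v)))"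
      by simp
    then show ?thesis using d by (simp add: scaleR_right_distrib)
  qed
  moreover have "(d / (1 + d)) *\<^sub>R v + (1 / (1 + d)) *\<^sub>R (x + d *\<^sub>R (x - v)) \<in> convex hull (insert v G)"
    using d G by (intro convexD[OF convex_convex_hull]) (auto intro: hull_inc simp: field_simps)
  ultimately show ?thesis using G that by metis
qed

text \<open>Induction on the dimension: \<open>F\<close> is the union of the cones from
  \<open>p F\<close> over its facets, and coning a cover of a facet covers the cone over that
  facet.\<close>

lemma flag_simplices_cover:
  fixes F :: "'a::euclidean_space set"
  assumes p: "\<And>G. polytope G \<Longrightarrow> G \<noteq> {} \<Longrightarrow> p G \<in> G"
    and "polytope F" "aff_dim F = int n"
  shows "(\<Union>L\<in>flag_simplices p n F. convex hull (set L)) = F"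
  using assms(2,3)
proof (induction n arbitrary: F)
  case 0
  then obtain a where a: "F = {a}" by (auto simp: aff_dim_eq_0)
  with p[of F] 0 show ?case by auto
next
  case (Suc n)
  have ne: "F \<noteq> {}" using Suc.prems by auto
  have v: "p F \<in> F" using p Suc.prems ne by blast
  have IH: "(\<Union>L\<in>flag_simplices p n G. convex hull (set L)) = G" if "G facet_of F" for G
    using that Suc by (auto simp: facet_of_def face_of_polytope_polytope)
  have cv: "convex F" using Suc.prems polytope_imp_convex by blast
  show ?case
  proof (intro equalityI subsetI)
    fix x assume "x \<in> (\<Union>L\<in>flag_simplices p (Suc n) F. convex hull (set L))"
    then obtain G M where G: "G facet_of F" "M \<in> flag_simplices p n G"
      "x \<in> convex hull (insert (p F) (set M))" by auto
    have "set M \<subseteq> G" using IH[OF G(1)] G(2) hull_subset by fastforce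
    then have "insert (p F) (set M) \<subseteq> F" using v facet_of_imp_subset[OF G(1)] by auto
    then show "x \<in> F" using G(3) hull_minimal[of _ F convex] cv by blast
  next
    fix x assume x: "x \<in> F"
    obtain G where G: "G facet_of F" "x \<in> convex hull (insert (p F) G)"
      using cone_over_facet[OF Suc.prems(1) v x] Suc.prems(2) by auto
    have "G \<noteq> {}" "convex G"
      using G(1) Suc.prems by (auto simp: facet_of_def face_of_imp_convex)
    then obtain u w y where y: "y \<in> G" "u \<ge> 0" "w \<ge> 0" "u + w = 1" "x = u *\<^sub>R p F + w *\<^sub>R y"
      using G(2) unfolding convex_hull_insert[OF \<open>G \<noteq> {}\<close>] by (auto simp: hull_same)
    then obtain M where M: "M \<in> flag_simplices p n G" "y \<in> convex hull (set M)"
      using IH[OF G(1)] by auto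
    have "y \<in> convex hull (set (p F # M))"
      using M(2) hull_mono[of "set M" "set (p F # M)"] by auto
    then have "x \<in> convex hull (set (p F # M))"
      using y by (auto intro!: convexD[OF convex_convex_hull] intro: hull_inc)
    with M(1) G(1) show "x \<in> (\<Union>L\<in>flag_simplices p (Suc n) F. convex hull (set L))" by force
  qed
qed

section \<open>Flag simplices do not overlap\<close>

lemma set_flag_simplex_subset:
  fixes F :: "'a::euclidean_space set"
  assumes "\<And>G. polytope G \<Longrightarrow> G \<noteq> {} \<Longrightarrow> p G \<in> G"
    and "polytope F" "aff_dim F = int n" "L \<in> flag_simplices p n F"
  shows "set L \<subseteq> F"
  using flag_simplices_cover[OF assms(1,2,3)] assms(4) hull_subset by fastforce

text \<open>For affinely independent points, relative interior means that all barycentric weights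
  are positive. Rescaling the weights on \<open>S\<close> by their sum \<open>s\<close> gives
  \<open>y\<close>, the projection of \<open>x\<close> from \<open>v\<close> to the opposite
  face.\<close>

lemma rel_interior_convex_hull_insert_cases:
  fixes S :: "'a::euclidean_space set"
  assumes ind: "\<not> affine_dependent (insert v S)" and v: "v \<notin> S" and ne: "S \<noteq> {}"
    and x: "x \<in> rel_interior (convex hull (insert v S))"
  obtains s y where "0 < s" "s < 1" "y \<in> rel_interior (convex hull S)"
    "x = (1 - s) *\<^sub>R v + s *\<^sub>R y"
proof -
  have fin: "finite S" using aff_independent_finite[OF ind] by simp
  have indS: "\<not> affine_dependent S" using affine_independent_subset[OF ind] by auto
  obtain u where u: "\<forall>z\<in>insert v S. 0 < u z" "sum u (insert v S) = 1"
    "(\<Sum>z\<in>insert v S. u z *\<^sub>R z) = x"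
    using x unfolding rel_interior_convex_hull_explicit[OF ind] by auto
  define s where "s = sum u S"
  have s: "u v = 1 - s" "0 < s" "s < 1"
  proof -
    show "0 < s" unfolding s_def using u fin ne by (intro sum_pos) auto
    show "u v = 1 - s" using u(2) fin v by (simp add: s_def)
    then show "s < 1" using u(1) by auto
  qed
  define y where "y = (\<Sum>z\<in>S. (u z / s) *\<^sub>R z)"
  have "y \<in> rel_interior (convex hull S)"
    unfolding rel_interior_convex_hull_explicit[OF indS] y_def
    using u s by (auto intro!: exI[of _ "\<lambda>z. u z / s"] simp: s_def[symmetric] sum_divide_distrib[symmetric])
  moreover have "s *\<^sub>R y = (\<Sum>z\<in>S. u z *\<^sub>R z)"
    using s by (simp add: y_def scaleR_sum_right)
  then have "x = (1 - s) *\<^sub>R v + s *\<^sub>R y"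
    using u(3) fin v s by simp
  ultimately show ?thesis using that s by blast
qed

text \<open>Both \<open>y\<close> and \<open>z\<close> lie on one ray from \<open>v\<close>. If
  \<open>z\<close> lies beyond \<open>y\<close>, then \<open>y\<close> is inside the segment from
  \<open>v\<close> to \<open>z\<close>, and the face \<open>G\<close> would contain
  \<open>v\<close>. If \<open>y\<close> lies beyond \<open>z\<close>, the same argument for
  \<open>G'\<close> puts \<open>y\<close> and \<open>v\<close> into \<open>G'\<close>, which rules
  out \<open>G' = G\<close>.\<close>

lemma ray_through_faces:
  fixes v y z :: "'a::euclidean_space"
  assumes G: "G face_of F" and G': "G' face_of F" and v: "v \<in> F" "v \<notin> G"
    and y: "y \<in> G" and z: "z \<in> G'" and s: "0 < s" and t: "0 \<le> t"
    and eq: "(1 - s) *\<^sub>R v + s *\<^sub>R y = (1 - t) *\<^sub>R v + t *\<^sub>R z"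
  shows "y \<in> G'" "G' = G \<Longrightarrow> y = z"
proof -
  have eq': "s *\<^sub>R (y - v) = t *\<^sub>R (z - v)"
    using eq by (simp add: algebra_simps)
  have yv: "y \<noteq> v" using y v by auto
  have t0: "t > 0" using eq' s t yv by (cases "t = 0") auto
  have yF: "y \<in> F" and zF: "z \<in> F" using y z G G' face_of_imp_subset by blast+
  have zv: "z \<noteq> v" using eq' s yv by auto
  have "\<not> t < s"
  proof
    assume "t < s"
    have "s *\<^sub>R y = s *\<^sub>R ((1 - t / s) *\<^sub>R v + (t / s) *\<^sub>R z)"
      using eq' s by (simp add: algebra_simps)
    then have "y = (1 - t / s) *\<^sub>R v + (t / s) *\<^sub>R z"
      using s by (subst (asm) scaleR_cancel_left) auto
    then have "y \<in> open_segment v z"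
      using zv s t0 \<open>t < s\<close> unfolding in_segment by (auto intro!: exI[of _ "t / s"])
    then have "v \<in> G" using G y v zF unfolding face_of_def by blast
    then show False using v by simp
  qed
  then consider "s = t" | "s < t" by linarith
  then have *: "y = z \<or> (y \<in> G' \<and> v \<in> G')"
  proof cases
    case 1
    then show ?thesis using eq' s by auto
  next
    case 2
    have "t *\<^sub>R z = t *\<^sub>R ((1 - s / t) *\<^sub>R v + (s / t) *\<^sub>R y)"
      using eq' t0 by (simp add: algebra_simps)
    then have "z = (1 - s / t) *\<^sub>R v + (s / t) *\<^sub>R y"
      using t0 by (subst (asm) scaleR_cancel_left) auto
    then have "z \<in> open_segment v y"
      using yv s t0 2 unfolding in_segment by (auto intro!: exI[of _ "s / t"])
    then show ?thesis using G' z v yF unfolding face_of_def by blast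
  qed
  show "y \<in> G'" using * z by auto
  show "G' = G \<Longrightarrow> y = z" using * v by auto
qed

text \<open>Induction on the dimension. Projecting \<open>x\<close> from the common apex gives a
  relative interior point of the base of \<open>L\<close>; it also lies in the facet used by
  \<open>L'\<close>, which forces the two facets to coincide. Full dimension of \<open>L\<close>
  keeps the apex out of its facet; a degenerate simplex could lie inside others.\<close>

lemma flag_simplices_overlap:
  fixes F :: "'a::euclidean_space set"
  assumes p: "\<And>G. polytope G \<Longrightarrow> G \<noteq> {} \<Longrightarrow> p G \<in> G"
    and "polytope F" "aff_dim F = int n"
    and "L \<in> flag_simplices p n F" "L' \<in> flag_simplices p n F"
    and "aff_dim (set L) = int n"
    and "x \<in> rel_interior (convex hull (set L))" "x \<in> convex hull (set L')"
  shows "L = L'"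
  using assms(2-)
proof (induction n arbitrary: F L L' x)
  case 0
  then show ?case by auto
next
  case (Suc n)
  define v where "v = p F"
  obtain G M where G: "G facet_of F" "M \<in> flag_simplices p n G" "L = v # M"
    using Suc.prems(3) by (auto simp: v_def)
  obtain G' M' where G': "G' facet_of F" "M' \<in> flag_simplices p n G'" "L' = v # M'"
    using Suc.prems(4) by (auto simp: v_def)
  have v: "v \<in> F" using p Suc.prems(1,2) unfolding v_def by force
  have fG: "G face_of F" "polytope G" "aff_dim G = int n" "G \<noteq> {}"
    using G(1) Suc.prems by (auto simp: facet_of_def face_of_polytope_polytope)
  have fG': "G' face_of F" "polytope G'" "aff_dim G' = int n" "G' \<noteq> {}"
    using G'(1) Suc.prems by (auto simp: facet_of_def face_of_polytope_polytope)
  have MG: "set M \<subseteq> G" by (rule set_flag_simplex_subset[OF p fG(2,3) G(2)])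
  have MG': "set M' \<subseteq> G'" by (rule set_flag_simplex_subset[OF p fG'(2,3) G'(2)])
  have hG: "convex hull set M \<subseteq> G" "convex hull set M' \<subseteq> G'"
    using hull_minimal[OF MG, of convex] hull_minimal[OF MG', of convex] fG(2) fG'(2)
    by (auto dest: polytope_imp_convex)
  have lM: "length M = Suc n" "length M' = Suc n"
    using length_flag_simplex[OF G(2)] length_flag_simplex[OF G'(2)] by auto
  have vG: "v \<notin> G"
  proof
    assume "v \<in> G"
    then have "aff_dim (set L) \<le> aff_dim G" using MG G(3) by (intro aff_dim_subset) auto
    then show False using Suc.prems(5) fG(3) by simp
  qed
  then have vM: "v \<notin> set M" using MG by auto
  \<comment> \<open>At most \<open>n + 2\<close> points spanning dimension \<open>n + 1\<close> must
    be exactly that many and affinely independent.\<close>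
  have "card (set L) \<le> Suc (Suc n)" using card_length[of L] G(3) lM by simp
  moreover have "aff_dim (set L) \<le> int (card (set L)) - 1" by (intro aff_dim_le_card) auto
  ultimately have cL: "card (set L) = Suc (Suc n)" using Suc.prems(5) by linarith
  then have ind: "\<not> affine_dependent (insert v (set M))"
    using Suc.prems(5) G(3) by (simp add: affine_independent_iff_card)
  have dM: "aff_dim (set M) = int n"
    using affine_independent_subset[OF ind, of "set M"] cL vM G(3)
    by (auto simp: affine_independent_iff_card)
  have neM: "set M \<noteq> {}" "set M' \<noteq> {}" using lM by auto
  obtain s y where y: "0 < s" "s < 1" "y \<in> rel_interior (convex hull (set M))"
      "x = (1 - s) *\<^sub>R v + s *\<^sub>R y"
    using rel_interior_convex_hull_insert_cases[OF ind vM neM(1)] Suc.prems(6) G(3) by auto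
  obtain t z where z: "0 \<le> t" "z \<in> convex hull (set M')" "x = (1 - t) *\<^sub>R v + t *\<^sub>R z"
  proof -
    have "x \<in> convex hull (insert v (set M'))" using Suc.prems(7) G'(3) by simp
    then obtain a t z where "0 \<le> t" "a + t = 1" "z \<in> convex hull (set M')" "x = a *\<^sub>R v + t *\<^sub>R z"
      unfolding convex_hull_insert[OF neM(2)] by auto
    moreover from this have "a = 1 - t" by simp
    ultimately show ?thesis using that by blast
  qed
  have yc: "y \<in> convex hull (set M)" using y(3) rel_interior_subset by blast
  have eq: "(1 - s) *\<^sub>R v + s *\<^sub>R y = (1 - t) *\<^sub>R v + t *\<^sub>R z" using y z by simp
  have ray: "y \<in> G'" "G' = G \<Longrightarrow> y = z"
    using ray_through_faces[OF fG(1) fG'(1) v vG _ _ y(1) z(1) eq] yc z(2) hG by auto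
  \<comment> \<open>A face that contains the relative interior point \<open>y\<close> of this hull
    contains the whole hull. Hence \<open>G \<inter> G'\<close> has the dimension of both facets,
    and a proper face would have a smaller one.\<close>
  have "convex hull set M \<subseteq> F" using hG fG(1) face_of_imp_subset by blast
  then have "convex hull set M \<subseteq> G'"
    using subset_of_face_of[OF fG'(1)] ray(1) y(3) by blast
  then have sub: "convex hull set M \<subseteq> G \<inter> G'" using hG by auto
  have d: "aff_dim (G \<inter> G') \<ge> int n" using aff_dim_subset[OF sub] dM by (simp add: aff_dim_convex_hull)
  have cG: "convex G" "convex G'" using fG fG' polytope_imp_convex by auto
  have fi: "G \<inter> G' face_of F" using face_of_Int fG fG' by blast
  have "G \<inter> G' face_of G" "G \<inter> G' face_of G'"
    using face_of_subset[OF fi] fG(1) fG'(1) face_of_imp_subset by auto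
  then have "G \<inter> G' = G" "G \<inter> G' = G'"
    using face_of_aff_dim_lt[OF cG(1)] face_of_aff_dim_lt[OF cG(2)] d fG fG' by fastforce+
  then have GG: "G' = G" by simp
  then have "y = z" using ray by simp
  then have "M = M'"
    using Suc.IH[OF fG(2,3) G(2) _ dM y(3)] G'(2) GG z(2) by simp
  then show ?case using G G' by simp
qed

lemma negligible_aff_dim_lt:
  fixes S :: "'a::euclidean_space set"
  assumes "convex S" "aff_dim S < int DIM('a)"
  shows "negligible S"
proof -
  have "interior S = {}" using assms(2) aff_dim_nonempty_interior[of S] by auto
  then show ?thesis using negligible_convex_interior[OF assms(1)] by simp
qed

text \<open>Either the first simplex is degenerate and hence null, or its interior misses the second
  one, so that they meet only in its frontier, which is null by convexity.\<close>

lemma flag_simplices_overlap_negligible: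
  fixes F :: "'a::euclidean_space set"
  assumes p: "\<And>G. polytope G \<Longrightarrow> G \<noteq> {} \<Longrightarrow> p G \<in> G"
    and F: "polytope F" "aff_dim F = int DIM('a)"
    and L: "L \<in> flag_simplices p DIM('a) F" "L' \<in> flag_simplices p DIM('a) F" "L \<noteq> L'"
  shows "negligible (convex hull (set L) \<inter> convex hull (set L'))"
proof (cases "aff_dim (set L) = int DIM('a)")
  case True
  have "interior (convex hull set L) = rel_interior (convex hull set L)"
    using True by (simp add: interior_rel_interior_gen aff_dim_convex_hull)
  then have "interior (convex hull set L) \<inter> convex hull set L' = {}"
    using flag_simplices_overlap[OF p F L(1,2) True] L(3) by auto
  then have "convex hull (set L) \<inter> convex hull (set L') \<subseteq> frontier (convex hull set L)"
    using closure_subset by (fastforce simp: frontier_def)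
  then show ?thesis
    using negligible_convex_frontier[OF convex_convex_hull] negligible_subset by blast
next
  case False
  have "aff_dim (convex hull set L) < int DIM('a)"
    using False aff_dim_le_DIM[of "set L"] by (simp add: aff_dim_convex_hull)
  then show ?thesis
    using negligible_aff_dim_lt[OF convex_convex_hull] negligible_subset by blast
qed

text \<open>The sets \<open>B L\<close> are left free so that the same additivity serves for whole
  simplices and for their parts in balls whose centre may vary with \<open>L\<close>.\<close>

lemma measure_flag_simplices_Union:
  fixes F :: "'a::euclidean_space set"
  assumes p: "\<And>G. polytope G \<Longrightarrow> G \<noteq> {} \<Longrightarrow> p G \<in> G"
    and F: "polytope F" "aff_dim F = int DIM('a)"
    and B: "\<And>L. L \<in> flag_simplices p DIM('a) F \<Longrightarrow> B L \<subseteq> convex hull (set L)"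
      "\<And>L. L \<in> flag_simplices p DIM('a) F \<Longrightarrow> compact (B L)"
  shows "measure lebesgue (\<Union>L\<in>flag_simplices p DIM('a) F. B L)
    = (\<Sum>L\<in>flag_simplices p DIM('a) F. measure lebesgue (B L))"
proof (rule measure_negligible_finite_Union_image)
  show "finite (flag_simplices p DIM('a) F)" by (rule finite_flag_simplices[OF F(1)])
  show "B L \<in> lmeasurable" if "L \<in> flag_simplices p DIM('a) F" for L
    using B(2)[OF that] lmeasurable_compact by blast
  show "pairwise (\<lambda>L L'. negligible (B L \<inter> B L')) (flag_simplices p DIM('a) F)"
    unfolding pairwise_def
    by (metis B(1) F Int_mono flag_simplices_overlap_negligible negligible_subset p)
qed

subsection \<open>Truncated Voronoi cells\<close>

text \<open>\<open>L ! i\<close> is the point nearest to 0 in a convex face that contains all later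
  entries, so this is the obtuse angle property of nearest points. Only \<open>i = 0\<close> needs
  it directly; larger indices descend to a facet.\<close>

lemma flag_simplex_inner_ge:
  fixes F :: "'a::euclidean_space set"
  assumes "polytope F" "aff_dim F = int n" "L \<in> flag_simplices (\<lambda>G. closest_point G 0) n F"
    and "i \<le> j" "j \<le> n"
  shows "L ! i \<bullet> L ! i \<le> L ! i \<bullet> L ! j"
  using assms
proof (induction n arbitrary: F L i j)
  case 0
  then show ?case by simp
next
  case (Suc n)
  obtain G M where G: "G facet_of F" "M \<in> flag_simplices (\<lambda>G. closest_point G 0) n G"
    "L = closest_point F 0 # M"
    using Suc.prems(3) by auto
  have pG: "polytope G" "aff_dim G = int n"
    using G(1) Suc.prems by (auto simp: facet_of_def face_of_polytope_polytope)
  show ?case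
  proof (cases i)
    case 0
    have "set L \<subseteq> F"
      by (rule set_flag_simplex_subset[OF _ Suc.prems(1-3)])
         (auto intro: closest_point_in_set polytope_imp_closed)
    moreover have "length L = Suc (Suc n)"
      by (rule length_flag_simplex[OF Suc.prems(3)])
    ultimately have "L ! j \<in> F" using Suc.prems(5) by (auto simp: subset_iff)
    then have "(0 - closest_point F 0) \<bullet> (L ! j - closest_point F 0) \<le> 0"
      using Suc.prems(1) by (intro closest_point_dot polytope_imp_closed polytope_imp_convex)
    then show ?thesis using 0 G(3) by (simp add: inner_diff_right)
  next
    case (Suc i')
    then obtain j' where "j = Suc j'" "i' \<le> j'" "j' \<le> n"
      using Suc.prems by (cases j) auto
    then show ?thesis using Suc.IH[OF pG G(2), of i' j'] Suc G(3) by simp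
  qed
qed

section \<open>Counting tight constraints along a flag\<close>

definition halfspaces_Int :: "('a::euclidean_space \<times> real) set \<Rightarrow> 'a set" where
  "halfspaces_Int H = {z. \<forall>(a, b)\<in>H. a \<bullet> z \<le> b}"

text \<open>Constraints are kept as coefficient pairs so that they can be counted. The count grows
  by at least one with each step down a flag and thus dominates the codimension.\<close>

definition tight_constraints :: "('a::euclidean_space \<times> real) set \<Rightarrow> 'a set \<Rightarrow> ('a \<times> real) set" where
  "tight_constraints H F = {(a, b)\<in>H. \<forall>z\<in>F. a \<bullet> z = b}"

lemma convex_halfspaces_Int: "convex (halfspaces_Int H)"
proof -
  have "halfspaces_Int H = (\<Inter>(a, b)\<in>H. {z. a \<bullet> z \<le> b})" by (auto simp: halfspaces_Int_def)
  then show ?thesis by (auto intro!: convex_INT convex_halfspace_le)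
qed

lemma polyhedron_halfspaces_Int: "finite H \<Longrightarrow> polyhedron (halfspaces_Int H)"
proof -
  assume "finite H"
  moreover have "halfspaces_Int H = (\<Inter>(a, b)\<in>H. {z. a \<bullet> z \<le> b})" by (auto simp: halfspaces_Int_def)
  ultimately show ?thesis by (auto intro!: polyhedron_Inter polyhedron_halfspace_le)
qed

text \<open>Take a relative interior point \<open>z\<close> of \<open>G\<close>. If every constraint
  tight at \<open>z\<close> were tight on \<open>F\<close>, then \<open>z\<close> could be moved
  slightly in every direction of the affine hull of \<open>F\<close> without leaving
  \<open>F\<close>. It would be a relative interior point of \<open>F\<close>, and a proper face
  contains none.\<close>

lemma tight_constraints_proper_face:
  fixes F :: "'a::euclidean_space set"
  assumes H: "finite H" and F: "F face_of halfspaces_Int H"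
    and G: "G face_of F" "G \<noteq> F" "G \<noteq> {}"
  shows "tight_constraints H F \<subset> tight_constraints H G"
proof -
  have GF: "G \<subseteq> F" "F \<subseteq> halfspaces_Int H" using F G face_of_imp_subset by auto
  have sub: "tight_constraints H F \<subseteq> tight_constraints H G"
    using GF by (auto simp: tight_constraints_def)
  have cG: "convex G" using G face_of_imp_convex by blast
  then obtain z where z: "z \<in> rel_interior G" using G(3) rel_interior_eq_empty by blast
  then have zG: "z \<in> G" using rel_interior_subset by blast
  have "\<exists>(a, b)\<in>H. a \<bullet> z = b \<and> (a, b) \<notin> tight_constraints H F"
  proof (rule ccontr)
    assume "\<not> ?thesis"
    then have all: "(a, b) \<in> tight_constraints H F" if "(a, b) \<in> H" "a \<bullet> z = b" for a b
      using that by auto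
    \<comment> \<open>The constraints that are slack at \<open>z\<close> stay slack on the open set
      \<open>U\<close>; the remaining ones hold with equality on the affine hull of
      \<open>F\<close>.\<close>
    define U where "U = (\<Inter>(a, b)\<in>{(a, b)\<in>H. a \<bullet> z < b}. {x. a \<bullet> x < b})"
    have "open U" unfolding U_def
      by (rule open_INT) (use H in \<open>auto simp: open_halfspace_lt intro: finite_subset[OF _ H]\<close>)
    moreover have "z \<in> U" by (auto simp: U_def)
    moreover have "U \<inter> affine hull F \<subseteq> F"
    proof
      fix x assume x: "x \<in> U \<inter> affine hull F"
      have "a \<bullet> x \<le> b" if ab: "(a, b) \<in> H" for a b
      proof (cases "a \<bullet> z = b")
        case True
        then have "F \<subseteq> {x. a \<bullet> x = b}" using all[OF ab] by (auto simp: tight_constraints_def)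
        then have "affine hull F \<subseteq> {x. a \<bullet> x = b}" by (intro hull_minimal affine_hyperplane)
        then show ?thesis using x by auto
      next
        case False
        have "a \<bullet> z \<le> b" using ab zG GF unfolding halfspaces_Int_def by blast
        then show ?thesis using False x ab by (force simp: U_def)
      qed
      then have "x \<in> halfspaces_Int H" by (auto simp: halfspaces_Int_def)
      then show "x \<in> F"
        using face_of_imp_eq_affine_Int[OF convex_halfspaces_Int F] x by blast
    qed
    ultimately have "z \<in> rel_interior F"
      using zG GF unfolding mem_rel_interior by blast
    then show False using face_of_disjoint_rel_interior[OF G(1,2)] zG by blast
  qed
  then obtain a b where ab: "(a, b) \<in> H" "a \<bullet> z = b" "(a, b) \<notin> tight_constraints H F" by auto
  have "a \<bullet> x \<le> b" if "x \<in> G" for x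
    using ab that GF unfolding halfspaces_Int_def by blast
  \<comment> \<open>The new constraint is so far tight only at \<open>z\<close>. It cuts out a face
    of \<open>G\<close> through a relative interior point, which must be all of
    \<open>G\<close>.\<close>
  then have "(G \<inter> {x. a \<bullet> x = b}) face_of G"
    by (rule face_of_Int_supporting_hyperplane_le[OF cG])
  then have "G \<subseteq> G \<inter> {x. a \<bullet> x = b}"
    by (rule subset_of_face_of) (use z zG ab in auto)
  then have "(a, b) \<in> tight_constraints H G" using ab by (auto simp: tight_constraints_def)
  then show ?thesis using sub ab by auto
qed

text \<open>Each of the \<open>k\<close> passages to a facet makes a further constraint tight. Of
  \<open>G\<close> only the membership of \<open>L ! k\<close> matters later: it turns tightness on
  \<open>G\<close> into equations for that point.\<close>

lemma flag_simplex_tight_constraints: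
  fixes F :: "'a::euclidean_space set"
  assumes H: "finite H"
    and p: "\<And>G. polytope G \<Longrightarrow> G \<noteq> {} \<Longrightarrow> p G \<in> G"
    and "polytope F" "aff_dim F = int n" "F face_of halfspaces_Int H"
    and "L \<in> flag_simplices p n F" "k \<le> n"
  shows "\<exists>G. L ! k \<in> G \<and> k + card (tight_constraints H F) \<le> card (tight_constraints H G)"
  using assms(3-)
proof (induction n arbitrary: F L k)
  case 0
  have "F \<noteq> {}" using 0 by auto
  then show ?case using 0 p by auto
next
  case (Suc n)
  obtain G M where G: "G facet_of F" "M \<in> flag_simplices p n G" "L = p F # M"
    using Suc.prems by auto
  have ne: "F \<noteq> {}" using Suc.prems by auto
  show ?case
  proof (cases k)
    case 0
    then show ?thesis using G(3) p[OF Suc.prems(1) ne] by auto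
  next
    case (Suc k')
    have fG: "G face_of F" "G \<noteq> {}" "G \<noteq> F" "polytope G" "aff_dim G = int n"
      using G(1) Suc.prems by (auto simp: facet_of_def face_of_polytope_polytope)
    have "G face_of halfspaces_Int H" using fG(1) Suc.prems(3) face_of_trans by blast
    then obtain G' where G': "M ! k' \<in> G'"
      "k' + card (tight_constraints H G) \<le> card (tight_constraints H G')"
      using Suc.IH[OF fG(4,5) _ G(2), of k'] Suc.prems(5) Suc by auto
    have "finite (tight_constraints H G)"
      by (rule finite_subset[OF _ H]) (auto simp: tight_constraints_def)
    then have "card (tight_constraints H F) < card (tight_constraints H G)"
      using tight_constraints_proper_face[OF H Suc.prems(3) fG(1,3,2)] psubset_card_mono by blast
    then show ?thesis using G' Suc G(3) by (intro exI[of _ G']) auto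
  qed
qed

lemma equidistant_separated_norm_ge:
  fixes X :: "'a::real_inner set"
  assumes X: "finite X" "X \<noteq> {}" and sep: "pairwise (\<lambda>x y. 2 \<le> dist x y) X"
    and eq: "\<And>x. x \<in> X \<Longrightarrow> (x - z) \<bullet> (x - z) = R"
  shows "2 * (real (card X) - 1) / real (card X) \<le> R"
proof -
  \<comment> \<open>Bound \<open>\<Sum>x y. \<bar>x - y\<bar>\<^sup>2\<close> below by separation and above by \<open>2 m\<^sup>2 R\<close>.\<close>
  define m where "m = real (card X)"
  have m: "m > 0" using X by (simp add: m_def card_gt_0_iff)
  \<comment> \<open>The subtracted 4 compensates for the diagonal term \<open>y = x\<close>, which
    is 0.\<close>
  have "(\<Sum>y\<in>X. 4::real) - 4 \<le> (\<Sum>y\<in>X. (x - y) \<bullet> (x - y))" if x: "x \<in> X" for x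
  proof -
    have "4 \<le> (x - y) \<bullet> (x - y)" if "y \<in> X - {x}" for y
    proof -
      have "2 \<le> norm (x - y)" using sep x that by (auto simp: pairwise_def dist_norm)
      then have "2\<^sup>2 \<le> (norm (x - y))\<^sup>2" by (intro power_mono) auto
      then show ?thesis by (simp add: power2_norm_eq_inner)
    qed
    then have "(\<Sum>y\<in>X-{x}. 4) \<le> (\<Sum>y\<in>X-{x}. (x - y) \<bullet> (x - y))" by (intro sum_mono)
    moreover have "(\<Sum>y\<in>X. f y) = f x + (\<Sum>y\<in>X-{x}. f y)" for f :: "'a \<Rightarrow> real"
      using X x by (simp add: sum.remove)
    ultimately show ?thesis by (metis (no_types, lifting) add_diff_cancel_left' add_cancel_left_left add_left_mono add.commute diff_add_cancel inner_zero_left right_minus_eq)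
  qed
  then have "(\<Sum>x\<in>X. (\<Sum>y\<in>X. 4) - 4) \<le> (\<Sum>x\<in>X. \<Sum>y\<in>X. (x - y) \<bullet> (x - y))" by (intro sum_mono)
  then have 1: "m * (4 * m - 4) \<le> (\<Sum>x\<in>X. \<Sum>y\<in>X. (x - y) \<bullet> (x - y))" by (simp add: m_def mult.commute)
  define s where "s = (\<Sum>x\<in>X. x - z)"
  have ss: "s \<bullet> s = (\<Sum>x\<in>X. \<Sum>y\<in>X. (x - z) \<bullet> (y - z))"
    unfolding s_def inner_sum_left inner_sum_right by (rule sum.swap)
  have "(x - y) \<bullet> (x - y) = R + R - 2 * ((x - z) \<bullet> (y - z))" if "x \<in> X" "y \<in> X" for x y
  proof -
    have "(x - y) \<bullet> (x - y) = ((x - z) - (y - z)) \<bullet> ((x - z) - (y - z))" by simp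
    also have "\<dots> = (x - z) \<bullet> (x - z) + (y - z) \<bullet> (y - z) - 2 * ((x - z) \<bullet> (y - z))"
      by (simp only: inner_diff_left inner_diff_right inner_commute) simp
    finally show ?thesis using eq that by simp
  qed
  then have "(\<Sum>x\<in>X. \<Sum>y\<in>X. (x - y) \<bullet> (x - y)) = (\<Sum>x\<in>X. \<Sum>y\<in>X. 2 * R - 2 * ((x - z) \<bullet> (y - z)))"
    by (intro sum.cong) auto
  also have "\<dots> = m * m * (2 * R) - 2 * (s \<bullet> s)"
    by (simp add: ss sum_subtractf sum_distrib_left[symmetric] m_def)
  also have "\<dots> \<le> m * m * (2 * R)" by simp
  finally have "m * (4 * m - 4) \<le> m * (m * (2 * R))" using 1 by simp
  then have "4 * m - 4 \<le> m * (2 * R)" using m by simp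
  then show ?thesis using m unfolding m_def[symmetric] by (simp add: field_simps)
qed

text \<open>The Voronoi cell of 0 with respect to the further centres \<open>Y\<close>, intersected with the cube
  \<open>[-2, 2]\<^sup>d\<close>. A pair \<open>(a, b)\<close> stands for the half-space \<open>a \<bullet> z \<le> b\<close>.\<close>

definition cell_constraints :: "'a::euclidean_space set \<Rightarrow> ('a \<times> real) set" where
  "cell_constraints Y =
     (\<lambda>y. (2 *\<^sub>R y, y \<bullet> y)) ` Y \<union> (\<lambda>b. (b, 2)) ` Basis \<union> (\<lambda>b. (- b, 2)) ` Basis"

definition truncated_cell :: "'a::euclidean_space set \<Rightarrow> 'a set" where
  "truncated_cell Y = halfspaces_Int (cell_constraints Y)"

lemma mem_truncated_cell:
  "z \<in> truncated_cell Y \<longleftrightarrow> (\<forall>y\<in>Y. 2 * (y \<bullet> z) \<le> y \<bullet> y) \<and> (\<forall>b\<in>Basis. \<bar>b \<bullet> z\<bar> \<le> 2)"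
  by (auto simp: truncated_cell_def halfspaces_Int_def cell_constraints_def abs_le_iff ball_Un)

text \<open>The crude bound by the sum of coordinates is enough: it makes the cell bounded, and
  later it enlarges the radius only by a constant, which disappears in the limit.\<close>

lemma truncated_cell_subset_cball:
  "truncated_cell Y \<subseteq> cball (0::'a::euclidean_space) (2 * real DIM('a))"
proof
  fix z :: 'a assume "z \<in> truncated_cell Y"
  then have "\<And>b. b \<in> Basis \<Longrightarrow> \<bar>z \<bullet> b\<bar> \<le> 2" by (auto simp: mem_truncated_cell inner_commute)
  then have "(\<Sum>b\<in>Basis. \<bar>z \<bullet> b\<bar>) \<le> (\<Sum>b\<in>(Basis::'a set). 2)" by (intro sum_mono)
  then show "z \<in> cball 0 (2 * real DIM('a))" using norm_le_l1[of z] by simp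
qed

lemma polytope_truncated_cell:
  assumes "finite Y" shows "polytope (truncated_cell Y)"
  unfolding polytope_eq_bounded_polyhedron
  using assms bounded_subset[OF bounded_cball truncated_cell_subset_cball]
  by (auto simp: truncated_cell_def cell_constraints_def intro!: polyhedron_halfspaces_Int)

text \<open>Choose \<open>k\<close> constraints tight at \<open>L ! k\<close>. If one is a side of
  the cube, the squared norm is at least 4. Otherwise all are bisectors, so the point is equidistant
  from 0 and \<open>k\<close> further centres; the bound is then the squared circumradius of a
  regular \<open>k\<close>-simplex of edge 2.\<close>

lemma truncated_cell_flag_norm_ge:
  fixes Y :: "'a::euclidean_space set"
  assumes Y: "finite Y" and sep: "pairwise (\<lambda>x y. 2 \<le> dist x y) (insert 0 Y)" "0 \<notin> Y"
    and p: "\<And>G. polytope G \<Longrightarrow> G \<noteq> {} \<Longrightarrow> p G \<in> G"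
    and dim: "aff_dim (truncated_cell Y) = int n"
    and L: "L \<in> flag_simplices p n (truncated_cell Y)" and k: "k \<le> n"
  shows "2 * real k / (real k + 1) \<le> L ! k \<bullet> L ! k"
proof -
  define z where "z = L ! k"
  define H where "H = cell_constraints Y"
  have H: "finite H" using Y by (simp add: H_def cell_constraints_def)
  have "truncated_cell Y face_of halfspaces_Int H"
    unfolding truncated_cell_def H_def by (rule face_of_refl[OF convex_halfspaces_Int])
  from flag_simplex_tight_constraints[OF H p polytope_truncated_cell[OF Y] dim this L k]
  obtain G where G: "z \<in> G" "k \<le> card (tight_constraints H G)" by (force simp: z_def)
  obtain A where A: "A \<subseteq> tight_constraints H G" "card A = k" "finite A"
    using obtain_subset_with_card_n[OF G(2)] by blast
  have AH: "A \<subseteq> H" and At: "\<And>a b. (a, b) \<in> A \<Longrightarrow> a \<bullet> z = b"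
    using A(1) G(1) by (auto simp: tight_constraints_def)
  show ?thesis
  proof (cases "\<exists>b\<in>Basis. (b, 2) \<in> A \<or> (- b, 2) \<in> A")
    case True
    then obtain b where b: "b \<in> Basis" "(b, 2) \<in> A \<or> (- b, 2) \<in> A" by auto
    then have "\<bar>z \<bullet> b\<bar> = 2" using At[of b 2] At[of "- b" 2] by (auto simp: inner_commute)
    then have "2 \<le> norm z" using Basis_le_norm[OF b(1), of z] by simp
    then have "2\<^sup>2 \<le> (norm z)\<^sup>2" by (intro power_mono) auto
    moreover have "2 * real k / (real k + 1) \<le> 4" by (simp add: field_simps)
    ultimately show ?thesis by (simp add: power2_norm_eq_inner z_def)
  next
    case False
    \<comment> \<open>A centre can be recovered from its constraint, so \<open>Z\<close> has exactly
      \<open>k\<close> elements.\<close>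
    define Z where "Z = {y\<in>Y. (2 *\<^sub>R y, y \<bullet> y) \<in> A}"
    have "A \<subseteq> (\<lambda>y. (2 *\<^sub>R y, y \<bullet> y)) ` Z"
      using AH False by (auto simp: H_def cell_constraints_def Z_def)
    moreover have "(\<lambda>y. (2 *\<^sub>R y, y \<bullet> y)) ` Z \<subseteq> A" by (auto simp: Z_def)
    ultimately have "A = (\<lambda>y. (2 *\<^sub>R y, y \<bullet> y)) ` Z" by auto
    then have cZ: "card Z = k" using A(2) by (simp add: card_image inj_on_def)
    have fZ: "finite Z" "Z \<subseteq> Y" using Y by (auto simp: Z_def)
    have "2 * (real (card (insert 0 Z)) - 1) / real (card (insert 0 Z)) \<le> z \<bullet> z"
    proof (rule equidistant_separated_norm_ge[where z=z])
      show "pairwise (\<lambda>x y. 2 \<le> dist x y) (insert 0 Z)"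
        by (rule pairwise_subset[OF sep(1)]) (use fZ in auto)
      fix x assume "x \<in> insert 0 Z"
      then consider "x = 0" | "(2 *\<^sub>R x, x \<bullet> x) \<in> A" by (auto simp: Z_def)
      then show "(x - z) \<bullet> (x - z) = z \<bullet> z"
      proof cases
        case 2
        then have "2 * (x \<bullet> z) = x \<bullet> x" using At[of "2 *\<^sub>R x" "x \<bullet> x"] by simp
        then show ?thesis by (simp add: inner_diff_left inner_diff_right inner_commute)
      qed simp
    qed (use fZ in auto)
    moreover have "0 \<notin> Z" using fZ sep(2) by auto
    ultimately show ?thesis using cZ fZ by (simp add: z_def add.commute)
  qed
qed

subsection \<open>Flags of the regular simplex\<close>

definition centroid :: "'a::real_vector set \<Rightarrow> 'a" where
  "centroid A = (1 / real (card A)) *\<^sub>R \<Sum>A"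

abbreviation extreme_points :: "'a::euclidean_space set \<Rightarrow> 'a set" where
  "extreme_points G \<equiv> {x. x extreme_point_of G}"

text \<open>This makes vertex centroids admissible apexes for the dissection; Krein-Milman
  guarantees that there are vertices to average.\<close>

lemma centroid_extreme_points_mem:
  fixes G :: "'a::euclidean_space set"
  assumes G: "polytope G" "G \<noteq> {}"
  shows "centroid (extreme_points G) \<in> G"
proof -
  let ?E = "extreme_points G"
  have fin: "finite ?E"
    using G finite_polyhedron_extreme_points polytope_imp_polyhedron by blast
  have "G = convex hull ?E"
    using G Krein_Milman_Minkowski polytope_imp_compact polytope_imp_convex by blast
  then have ne: "?E \<noteq> {}" using G by force
  have "?E \<subseteq> G" by (auto simp: extreme_point_of_def)
  moreover have "centroid ?E = (\<Sum>x\<in>?E. (1 / real (card ?E)) *\<^sub>R x)"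
    by (simp add: centroid_def scaleR_sum_right)
  moreover have "(\<Sum>x\<in>?E. (1 / real (card ?E)) *\<^sub>R x) \<in> G"
    using fin ne calculation(1) polytope_imp_convex[OF G(1)]
    by (intro convex_sum) auto
  ultimately show ?thesis by simp
qed

text \<open>Relative to \<open>u\<close>, the nonzero vectors have squared norm 4 and mutual inner
  product 2. So each nonzero row of the Gram matrix sums to \<open>2 * card B\<close>, and after
  normalisation only the size of the smaller set \<open>A\<close> remains.\<close>

lemma centroid_inner:
  fixes B :: "'a::real_inner set"
  assumes B: "finite B" and A: "A \<subseteq> B" and u: "u \<in> A"
    and dist: "\<And>x y. x \<in> B \<Longrightarrow> y \<in> B \<Longrightarrow> x \<noteq> y \<Longrightarrow> dist x y = 2"
  shows "(centroid A - u) \<bullet> (centroid B - u) = 2 * (real (card A) - 1) / real (card A)"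
proof -
  have fA: "finite A" using A B finite_subset by blast
  have pos: "card A > 0" "card B > 0" using fA B u A by (auto simp: card_gt_0_iff)
  have c: "centroid D - u = (1 / real (card D)) *\<^sub>R (\<Sum>x\<in>D. x - u)" if "card D > 0" for D
    using that by (simp add: centroid_def sum_subtractf scaleR_diff_right sum_constant_scaleR)
  have ip: "(x - u) \<bullet> (y - u) = (if x = y then 4 else 2)"
    if "x \<in> B - {u}" "y \<in> B - {u}" for x y
  proof -
    have n: "(p - q) \<bullet> (p - q) = 4" if "p \<in> B" "q \<in> B" "p \<noteq> q" for p q
      using dist[OF that] power2_norm_eq_inner[of "p - q"] by (simp add: dist_norm)
    have "(x - y) \<bullet> (x - y) = ((x - u) - (y - u)) \<bullet> ((x - u) - (y - u))" by simp
    also have "\<dots> = (x - u) \<bullet> (x - u) + (y - u) \<bullet> (y - u) - 2 * ((x - u) \<bullet> (y - u))"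
      by (simp only: inner_diff_left inner_diff_right inner_commute) simp
    finally show ?thesis using n[of x u] n[of y u] n[of x y] that u A by auto
  qed
  have row: "(\<Sum>y\<in>B. (x - u) \<bullet> (y - u)) = 2 * real (card B)" if x: "x \<in> A - {u}" for x
  proof -
    have "(\<Sum>y\<in>B. (x - u) \<bullet> (y - u)) = (\<Sum>y\<in>B - {u}. (x - u) \<bullet> (y - u))"
      by (rule sum.mono_neutral_right) (use B in auto)
    also have "\<dots> = (\<Sum>y\<in>B - {u}. 2 + (if x = y then 2 else 0))"
      using x A by (intro sum.cong) (auto simp: ip)
    also have "\<dots> = 2 * real (card (B - {u})) + 2"
      using x A B by (simp add: sum.distrib subset_iff)
    also have "\<dots> = 2 * real (card B)"
      using B u A pos by (simp add: of_nat_diff subset_iff Suc_le_eq algebra_simps)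
    finally show ?thesis .
  qed
  have "(\<Sum>x\<in>A. x - u) \<bullet> (\<Sum>y\<in>B. y - u) = (\<Sum>x\<in>A. \<Sum>y\<in>B. (x - u) \<bullet> (y - u))"
    unfolding inner_sum_left inner_sum_right by (rule sum.swap)
  also have "\<dots> = (\<Sum>x\<in>A - {u}. \<Sum>y\<in>B. (x - u) \<bullet> (y - u))"
    by (rule sum.mono_neutral_right) (use fA in auto)
  also have "\<dots> = (real (card A) - 1) * (2 * real (card B))"
    using fA u pos by (simp add: row of_nat_diff Suc_le_eq)
  finally show ?thesis using pos by (simp add: c field_simps)
qed

text \<open>Facets of a simplex arise by dropping one vertex, so a flag is a decreasing chain of
  vertex sets \<open>A i\<close>, and the chosen points are their centroids. The last set is a
  single vertex, the last entry of \<open>M\<close>.\<close>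

lemma barycentric_flag_chain:
  fixes S :: "'a::euclidean_space set"
  assumes "\<not> affine_dependent S" "card S = Suc n"
    and "M \<in> flag_simplices (\<lambda>G. centroid (extreme_points G)) n (convex hull S)"
  shows "\<exists>A. M ! n \<in> A n \<and> A 0 = S \<and>
    (\<forall>i\<le>n. M ! i = centroid (A i) \<and> card (A i) = Suc (n - i) \<and> (\<forall>j\<le>i. A i \<subseteq> A j))"
  using assms
proof (induction n arbitrary: S M)
  case 0
  then obtain u where "S = {u}" by (auto simp: card_1_singleton_iff)
  then have "M = [u]" using 0 by (simp add: centroid_def)
  then show ?case using \<open>S = {u}\<close> by (intro exI[of _ "\<lambda>_. {u}"]) (auto simp: centroid_def)
next
  case (Suc n)
  let ?p = "\<lambda>G. centroid (extreme_points G)"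
  obtain G N where G: "G facet_of convex hull S" "N \<in> flag_simplices ?p n G"
    "M = ?p (convex hull S) # N"
    using Suc.prems(3) by auto
  obtain u where u: "u \<in> S" "G = convex hull (S - {u})"
    using G(1) facet_of_convex_hull_affine_independent[OF Suc.prems(1)] by auto
  have fS: "finite S" by (rule aff_independent_finite[OF Suc.prems(1)])
  have "\<not> affine_dependent (S - {u})"
    using affine_independent_subset[OF Suc.prems(1)] by auto
  moreover have "card (S - {u}) = Suc n" using u(1) Suc.prems(2) fS by simp
  ultimately obtain A where A: "N ! n \<in> A n" "A 0 = S - {u}"
    "\<And>i j. i \<le> n \<Longrightarrow> N ! i = centroid (A i) \<and> card (A i) = Suc (n - i) \<and> (j \<le> i \<longrightarrow> A i \<subseteq> A j)"
    using Suc.IH[of "S - {u}" N] G(2) u(2) by auto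
  have "?p (convex hull S) = centroid S"
    using extreme_point_of_convex_hull_affine_independent[OF Suc.prems(1)] by simp
  then have M: "M ! 0 = centroid S" "\<And>i. M ! Suc i = N ! i" using G(3) by auto
  define A' where "A' i = (case i of 0 \<Rightarrow> S | Suc i \<Rightarrow> A i)" for i
  have "A i \<subseteq> S" if "i \<le> n" for i using A(3)[OF that, of 0] A(2) by auto
  then have "\<forall>j\<le>i. A' i \<subseteq> A' j" if "i \<le> Suc n" for i
    using that A(3) by (auto simp: A'_def split: nat.splits)
  moreover have "M ! i = centroid (A' i) \<and> card (A' i) = Suc (Suc n - i)" if "i \<le> Suc n" for i
    using that A(3) M Suc.prems(2) by (auto simp: A'_def split: nat.splits)
  ultimately show ?case
    using A(1) M by (intro exI[of _ A']) (auto simp: A'_def)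
qed

text \<open>Indices count from the end of the flag: entry \<open>n - i\<close> is the centroid of an
  \<open>i\<close>-dimensional face containing the vertex \<open>M ! n\<close>. The value is exactly
  the lower bound found for the flags of the truncated cell.\<close>

lemma barycentric_flag_inner:
  fixes S :: "'a::euclidean_space set"
  assumes S: "\<not> affine_dependent S" "card S = Suc n"
    and dist: "\<And>x y. x \<in> S \<Longrightarrow> y \<in> S \<Longrightarrow> x \<noteq> y \<Longrightarrow> dist x y = 2"
    and M: "M \<in> flag_simplices (\<lambda>G. centroid (extreme_points G)) n (convex hull S)"
  shows "M ! n \<in> S"
    and "i \<le> j \<Longrightarrow> j \<le> n \<Longrightarrow>
      (M ! (n - i) - M ! n) \<bullet> (M ! (n - j) - M ! n) = 2 * real i / (real i + 1)"
proof -
  obtain A where A: "M ! n \<in> A n" "A 0 = S"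
    "\<And>i j. i \<le> n \<Longrightarrow> M ! i = centroid (A i) \<and> card (A i) = Suc (n - i) \<and> (j \<le> i \<longrightarrow> A i \<subseteq> A j)"
    using barycentric_flag_chain[OF S M] by auto
  show "M ! n \<in> S" using A(1) A(2) A(3)[of n 0] by auto
  assume ij: "i \<le> j" "j \<le> n"
  have sub: "A (n - j) \<subseteq> S" "A (n - i) \<subseteq> A (n - j)" "M ! n \<in> A (n - i)"
    using A(3)[of "n - j" 0] A(3)[of "n - i" "n - j"] A(3)[of n "n - i"] ij A(1,2) by auto
  have "finite S" using S(1) aff_independent_finite by blast
  then have "finite (A (n - j))" using sub finite_subset by blast
  then have "(centroid (A (n - i)) - M ! n) \<bullet> (centroid (A (n - j)) - M ! n)
      = 2 * (real (card (A (n - i))) - 1) / real (card (A (n - i)))"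
    by (rule centroid_inner) (use sub in \<open>auto intro: dist\<close>)
  then show "(M ! (n - i) - M ! n) \<bullet> (M ! (n - j) - M ! n) = 2 * real i / (real i + 1)"
    using A(3)[of "n - i"] A(3)[of "n - j"] ij by (simp add: add.commute)
qed

subsection \<open>Density comparison\<close>

text \<open>Both squared norms expand into the same nonnegative combination of Gram matrix
  entries.\<close>

lemma norm_sum_scaleR_mono:
  fixes v w :: "'i \<Rightarrow> 'a::real_inner"
  assumes "\<And>i. i \<in> I \<Longrightarrow> 0 \<le> c i"
    and "\<And>i j. i \<in> I \<Longrightarrow> j \<in> I \<Longrightarrow> w i \<bullet> w j \<le> v i \<bullet> v j"
  shows "norm (\<Sum>i\<in>I. c i *\<^sub>R w i) \<le> norm (\<Sum>i\<in>I. c i *\<^sub>R v i)"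
proof -
  have eq: "(\<Sum>i\<in>I. c i *\<^sub>R x i) \<bullet> (\<Sum>i\<in>I. c i *\<^sub>R x i) = (\<Sum>i\<in>I. \<Sum>j\<in>I. (c i * c j) * (x j \<bullet> x i))"
    for x :: "'i \<Rightarrow> 'a"
    by (simp add: inner_sum_left inner_sum_right sum_distrib_left mult.assoc)
  show ?thesis unfolding norm_le eq
    using assms by (intro sum_mono mult_left_mono) auto
qed

text \<open>When \<open>w\<close> repeats a point, its whole weight goes to one chosen index and the
  other indices get weight 0.\<close>

lemma convex_hull_image_coeffs:
  fixes w :: "'i \<Rightarrow> 'a::real_vector"
  assumes I: "finite I" and x: "x \<in> convex hull (w ` I)"
  shows "\<exists>c. (\<forall>i\<in>I. 0 \<le> c i) \<and> x = (\<Sum>i\<in>I. c i *\<^sub>R w i)"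
proof -
  obtain u where u: "\<And>y. y \<in> w ` I \<Longrightarrow> 0 \<le> u y" "x = (\<Sum>y\<in>w ` I. u y *\<^sub>R y)"
    using x I by (auto simp: convex_hull_finite)
  define g where "g = inv_into I w"
  have g: "\<And>y. y \<in> w ` I \<Longrightarrow> g y \<in> I \<and> w (g y) = y"
    by (simp add: g_def inv_into_into f_inv_into_f)
  have inj: "inj_on g (w ` I)" by (rule inj_on_inverseI[of _ w]) (simp add: g)
  define c where "c i = (if i \<in> g ` w ` I then u (w i) else 0)" for i
  have "(\<Sum>i\<in>I. c i *\<^sub>R w i) = (\<Sum>i\<in>g ` w ` I. u (w i) *\<^sub>R w i)"
    by (rule sum.mono_neutral_cong_right) (use I g in \<open>auto simp: c_def\<close>)
  also have "\<dots> = x"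
    unfolding u(2) by (subst sum.reindex[OF inj]) (simp add: g)
  finally show ?thesis using u(1) by (intro exI[of _ c]) (auto simp: c_def)
qed

text \<open>If the vertices other than 0 failed to span, the simplex would lie in a proper subspace
  and be null. As many spanning vectors as the dimension are distinct and independent.\<close>

lemma independent_of_not_negligible_simplex:
  fixes w :: "nat \<Rightarrow> 'a::euclidean_space"
  assumes w0: "w 0 = 0" and neg: "\<not> negligible (convex hull (w ` {..DIM('a)}))"
  shows "independent (w ` {1..DIM('a)})" "inj_on w {1..DIM('a)}" "span (w ` {1..DIM('a)}) = UNIV"
proof -
  let ?B = "w ` {1..DIM('a)}"
  have ins: "w ` {..DIM('a)} = insert 0 ?B"
    proof -
    have "{..DIM('a)} = insert 0 {1..DIM('a)}" by auto
    then show ?thesis using w0 by (metis image_insert)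
  qed
  have "dim (insert 0 ?B) \<ge> DIM('a)"
  proof (rule ccontr)
    assume "\<not> ?thesis"
    moreover have "dim (convex hull (insert 0 ?B)) \<le> dim (span (insert 0 ?B))"
      by (intro dim_subset convex_hull_subset_span)
    ultimately have "dim (convex hull (insert 0 ?B)) < DIM('a)" by (simp add: dim_span dim_insert span_zero)
    then show False using negligible_lowdim neg ins by auto
  qed
  then have dB: "dim ?B = DIM('a)" using dim_subset_UNIV[of ?B] by (simp add: dim_insert span_zero)
  then show "span ?B = UNIV" using dim_eq_full by blast
  have c: "card ?B \<le> DIM('a)" using card_image_le[of "{1..DIM('a)}" w] by simp
  then show ind: "independent ?B"
    using dB by (intro card_le_dim_spanning[of ?B ?B]) (auto intro: span_base)
  then have "card ?B = DIM('a)" using dB dim_eq_card_independent by metis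
  then show "inj_on w {1..DIM('a)}" by (intro eq_card_imp_inj_on) auto
qed

text \<open>The linear map sending each \<open>w i\<close> to \<open>v i\<close> carries
  \<open>W\<close> onto \<open>V\<close> and shortens no vector of \<open>W\<close>. The product
  form of the density comparison also covers degenerate simplices, where the left side is 0.\<close>

lemma simplex_density_le:
  fixes v w :: "nat \<Rightarrow> 'a::euclidean_space"
  defines "V \<equiv> convex hull (v ` {..DIM('a)})" and "W \<equiv> convex hull (w ` {..DIM('a)})"
  assumes v0: "v 0 = 0" and w0: "w 0 = 0"
    and le: "\<And>i j. i \<le> DIM('a) \<Longrightarrow> j \<le> DIM('a) \<Longrightarrow> w i \<bullet> w j \<le> v i \<bullet> v j"
  shows "measure lebesgue (V \<inter> cball 0 r) * measure lebesgue W
    \<le> measure lebesgue V * measure lebesgue (W \<inter> cball 0 r)"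
proof -
  have cV: "compact V" "compact W"
    unfolding V_def W_def by (auto intro!: finite_imp_compact_convex_hull)
  consider "negligible V" | "negligible W" | "\<not> negligible V" "\<not> negligible W" by blast
  then show ?thesis
  proof cases
    case 1
    then have "negligible (V \<inter> cball 0 r)" by (rule negligible_subset) auto
    then show ?thesis using 1 by (simp add: negligible_imp_measure0)
  next
    case 2
    then show ?thesis by (simp add: negligible_imp_measure0)
  next
    case 3
    note iv = independent_of_not_negligible_simplex[of v, OF v0 3(1)[unfolded V_def]]
    note iw = independent_of_not_negligible_simplex[of w, OF w0 3(2)[unfolded W_def]]
    obtain f where f: "linear f" "\<And>x. x \<in> w ` {1..DIM('a)} \<Longrightarrow> f x = v (inv_into {1..DIM('a)} w x)"
      using linear_independent_extend[OF iw(1), of "\<lambda>x. v (inv_into {1..DIM('a)} w x)"] by auto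
    have fw: "f (w i) = v i" if "i \<le> DIM('a)" for i
    proof (cases "i = 0")
      case True
      then show ?thesis using f(1) v0 w0 linear_0 by metis
    next
      case False
      then have "i \<in> {1..DIM('a)}" using that by auto
      then show ?thesis using f(2)[of "w i"] iw(2) by (simp add: inv_into_f_f)
    qed
    have "v ` {1..DIM('a)} \<subseteq> range f" using fw by (auto simp: image_iff) (metis)
    then have "span (v ` {1..DIM('a)}) \<subseteq> range f"
      using f(1) by (intro span_minimal linear_subspace_image subspace_UNIV)
    then have "surj f" using iv(3) by auto
    then have "inj f" using f(1) linear_surjective_imp_injective by blast
    then obtain c where c: "c \<ge> 0" "\<And>S. compact S \<Longrightarrow> measure lebesgue (f ` S) = c * measure lebesgue S"
      using measure_linear_image_compact[OF f(1)] by blast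
    have "f ` w ` {..DIM('a)} = v ` {..DIM('a)}" using fw by (force simp: image_iff)
    then have fW: "f ` W = V"
      unfolding V_def W_def by (simp add: convex_hull_linear_image[OF f(1)])
    have expand: "norm x \<le> norm (f x)" if "x \<in> W" for x
    proof -
      have x: "x \<in> convex hull (w ` {..DIM('a)})" using that W_def by simp
      obtain a where a: "\<forall>i\<in>{..DIM('a)}. 0 \<le> a i" "x = (\<Sum>i\<le>DIM('a). a i *\<^sub>R w i)"
        using convex_hull_image_coeffs[OF finite_atMost x] by blast
      have "f x = (\<Sum>i\<le>DIM('a). a i *\<^sub>R v i)"
        using fw by (simp add: a(2) linear_sum[OF f(1)] linear_cmul[OF f(1)])
      then show ?thesis unfolding a(2)
        using norm_sum_scaleR_mono[of "{..DIM('a)}" a w v] a(1) le by (simp add: a(2))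
    qed
    \<comment> \<open>Since \<open>f\<close> does not shorten, a point whose image lies in the ball
      was already in the ball.\<close>
    have "V \<inter> cball 0 r \<subseteq> f ` (W \<inter> cball 0 r)"
      using expand fW by force
    moreover have cW: "compact (W \<inter> cball 0 r)" "compact (V \<inter> cball 0 r)"
      using cV by (auto intro: compact_Int_closed)
    moreover have "compact (f ` (W \<inter> cball 0 r))"
      using cW f(1) by (intro compact_continuous_image linear_continuous_on)
        (auto simp: linear_conv_bounded_linear)
    ultimately have "measure lebesgue (V \<inter> cball 0 r) \<le> measure lebesgue (f ` (W \<inter> cball 0 r))"
      by (intro measure_mono_fmeasurable) (auto intro: lmeasurable_compact fmeasurableD)
    then have "measure lebesgue (V \<inter> cball 0 r) \<le> c * measure lebesgue (W \<inter> cball 0 r)"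
      using c(2)[OF cW(1)] by simp
    moreover have "measure lebesgue V = c * measure lebesgue W" using c(2)[OF cV(2)] fW by simp
    ultimately show ?thesis
      using mult_right_mono[of _ _ "measure lebesgue W"] by (fastforce simp: mult_ac)
  qed
qed

text \<open>The unit ball fits into the cell because the centres are at least 2 apart. So the cell
  has full dimension, and the first vertex of each of its flag simplices is 0.\<close>

lemma zero_mem_interior_truncated_cell:
  assumes "pairwise (\<lambda>x y. 2 \<le> dist x y) (insert 0 Y)" "0 \<notin> Y"
  shows "(0::'a::euclidean_space) \<in> interior (truncated_cell Y)"
proof -
  have "ball 0 1 \<subseteq> truncated_cell Y"
  proof
    fix z :: 'a assume "z \<in> ball 0 1"
    then have z: "norm z < 1" by simp
    have "2 * (y \<bullet> z) \<le> y \<bullet> y" if y: "y \<in> Y" for y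
    proof -
      have "2 \<le> norm y" using assms y unfolding pairwise_insert by force
      then have "norm z * 2 \<le> norm y" using z by linarith
      then have "norm y * (norm z * 2) \<le> norm y * norm y" by (rule mult_left_mono) simp
      moreover have "y \<bullet> z \<le> norm y * norm z" by (rule norm_cauchy_schwarz)
      ultimately show ?thesis by (simp add: norm_eq_sqrt_inner)
    qed
    moreover have "\<bar>b \<bullet> z\<bar> \<le> 2" if "b \<in> Basis" for b
      using Basis_le_norm[OF that, of z] z by (simp add: inner_commute)
    ultimately show "z \<in> truncated_cell Y" by (simp add: mem_truncated_cell)
  qed
  then show ?thesis using interior_maximal[of "ball 0 1" "truncated_cell Y"] by auto
qed

lemma flag_simplex_density_le:
  fixes Y S :: "'a::euclidean_space set"
  assumes Y: "finite Y" and sep: "pairwise (\<lambda>x y. 2 \<le> dist x y) (insert 0 Y)" "0 \<notin> Y"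
    and S: "\<not> affine_dependent S" "card S = Suc DIM('a)"
    and dist: "\<And>x y. x \<in> S \<Longrightarrow> y \<in> S \<Longrightarrow> x \<noteq> y \<Longrightarrow> dist x y = 2"
    and L: "L \<in> flag_simplices (\<lambda>G. closest_point G 0) DIM('a) (truncated_cell Y)"
    and M: "M \<in> flag_simplices (\<lambda>G. centroid (extreme_points G)) DIM('a) (convex hull S)"
  shows "measure lebesgue (convex hull (set L) \<inter> cball 0 r) * measure lebesgue (convex hull (set M))
    \<le> measure lebesgue (convex hull (set L)) *
      measure lebesgue (convex hull (set M) \<inter> cball (M ! DIM('a)) r)"
proof -
  let ?d = "DIM('a)"
  let ?C = "truncated_cell Y"
  define u where "u = M ! ?d"
  \<comment> \<open>The reversal pairs \<open>i\<close>-dimensional faces of the regular simplex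
    with faces of codimension \<open>i\<close> of the cell.\<close>
  define w where "w i = M ! (?d - i) - u" for i
  have C: "polytope ?C" "0 \<in> ?C"
    using polytope_truncated_cell[OF Y] zero_mem_interior_truncated_cell[OF sep] interior_subset by auto
  have dC: "aff_dim ?C = int ?d"
    using zero_mem_interior_truncated_cell[OF sep] by (intro aff_dim_nonempty_interior) auto
  have L0: "L ! 0 = 0"
    using hd_flag_simplex[OF L] closest_point_self[OF C(2)] by simp
  have len: "length L = Suc ?d" "length M = Suc ?d"
    using length_flag_simplex[OF L] length_flag_simplex[OF M] by auto
  have setL: "set L = (!) L ` {..?d}"
    using len by (auto simp: set_conv_nth image_iff less_Suc_eq_le)
  have "set M = (!) M ` (\<lambda>i. ?d - i) ` {..?d}"
  proof -
    have "(\<lambda>i. ?d - i) ` {..?d} = {..?d}"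
    proof (intro equalityI subsetI)
      fix k assume "k \<in> {..?d}"
      then show "k \<in> (\<lambda>i. ?d - i) ` {..?d}" by (intro image_eqI[of _ _ "?d - k"]) auto
    qed auto
    then show ?thesis using len by (auto simp: set_conv_nth image_iff less_Suc_eq_le)
  qed
  also have "\<dots> = (+) u ` w ` {..?d}" by (simp add: image_image w_def)
  finally have setM: "convex hull (set M) = (+) u ` (convex hull (w ` {..?d}))"
    by (simp add: convex_hull_translation)
  have le': "w i \<bullet> w j \<le> L ! i \<bullet> L ! j" if ij: "i \<le> j" "j \<le> ?d" for i j
  proof -
    have "w i \<bullet> w j = 2 * real i / (real i + 1)"
      unfolding w_def u_def by (rule barycentric_flag_inner(2)[OF S dist M ij])
    also have "\<dots> \<le> L ! i \<bullet> L ! i"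
      by (rule truncated_cell_flag_norm_ge[OF Y sep _ dC L])
         (use ij in \<open>auto intro: closest_point_in_set polytope_imp_closed\<close>)
    also have "\<dots> \<le> L ! i \<bullet> L ! j"
      by (rule flag_simplex_inner_ge[OF C(1) dC L ij])
    finally show ?thesis .
  qed
  have le: "w i \<bullet> w j \<le> L ! i \<bullet> L ! j" if "i \<le> ?d" "j \<le> ?d" for i j
    using le'[of i j] le'[of j i] that by (cases "i \<le> j") (auto simp: inner_commute)
  have "measure lebesgue (convex hull ((!) L ` {..?d}) \<inter> cball 0 r) * measure lebesgue (convex hull (w ` {..?d}))
    \<le> measure lebesgue (convex hull ((!) L ` {..?d})) * measure lebesgue (convex hull (w ` {..?d}) \<inter> cball 0 r)"
    by (rule simplex_density_le) (use L0 le in \<open>auto simp: w_def u_def\<close>)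
  moreover have "convex hull (set M) \<inter> cball u r = (+) u ` (convex hull (w ` {..?d}) \<inter> cball 0 r)"
    unfolding setM by (auto simp: dist_norm)
  ultimately show ?thesis
    by (simp add: setL u_def[symmetric]) (simp add: setM measure_translation)
qed

text \<open>Sum the comparison over all pairs of flags. Both sides are products, so the double sums
  factor into the volumes of the dissected bodies.\<close>

lemma truncated_cell_density_le:
  fixes Y S :: "'a::euclidean_space set"
  assumes Y: "finite Y" and sep: "pairwise (\<lambda>x y. 2 \<le> dist x y) (insert 0 Y)" "0 \<notin> Y"
    and S: "\<not> affine_dependent S" "card S = Suc DIM('a)"
    and dist: "\<And>x y. x \<in> S \<Longrightarrow> y \<in> S \<Longrightarrow> x \<noteq> y \<Longrightarrow> dist x y = 2"
  shows "measure lebesgue (truncated_cell Y \<inter> cball 0 r) * measure lebesgue (convex hull S)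
    \<le> measure lebesgue (truncated_cell Y) *
      measure lebesgue (convex hull S \<inter> (\<Union>u\<in>S. cball u r))"
proof -
  let ?d = "DIM('a)" and ?C = "truncated_cell Y" and ?T = "convex hull S"
  let ?p = "\<lambda>G::'a set. closest_point G 0" and ?q = "\<lambda>G::'a set. centroid (extreme_points G)"
  let ?FL = "flag_simplices ?p ?d ?C" and ?FM = "flag_simplices ?q ?d ?T"
  have fS: "finite S" by (rule aff_independent_finite[OF S(1)])
  have p: "polytope G \<Longrightarrow> G \<noteq> {} \<Longrightarrow> ?p G \<in> G" for G
    by (auto intro: closest_point_in_set polytope_imp_closed)
  have C: "polytope ?C" by (rule polytope_truncated_cell[OF Y])
  have dC: "aff_dim ?C = int ?d"
    using zero_mem_interior_truncated_cell[OF sep] by (intro aff_dim_nonempty_interior) auto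
  have T: "polytope ?T" using fS by (rule polytope_convex_hull)
  have dT: "aff_dim ?T = int ?d" using S by (simp add: aff_dim_convex_hull affine_independent_iff_card)
  have cc: "compact (convex hull (set K) \<inter> cball a r)" for K and a :: 'a
    by (auto intro!: compact_Int_closed finite_imp_compact_convex_hull)
  have coverL: "(\<Union>L\<in>?FL. convex hull (set L)) = ?C" by (rule flag_simplices_cover[OF p C dC])
  have coverM: "(\<Union>M\<in>?FM. convex hull (set M)) = ?T"
    by (rule flag_simplices_cover[OF centroid_extreme_points_mem T dT])
  have mC: "measure lebesgue ?C = (\<Sum>L\<in>?FL. measure lebesgue (convex hull (set L)))"
    using measure_flag_simplices_Union[OF p C dC, of "\<lambda>L. convex hull (set L)"]
    by (simp add: coverL finite_imp_compact_convex_hull)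
  have mCr: "measure lebesgue (?C \<inter> cball 0 r) = (\<Sum>L\<in>?FL. measure lebesgue (convex hull (set L) \<inter> cball 0 r))"
  proof -
    have "?C \<inter> cball 0 r = (\<Union>L\<in>?FL. convex hull (set L) \<inter> cball 0 r)" using coverL by blast
    then show ?thesis
      using measure_flag_simplices_Union[OF p C dC, of "\<lambda>L. convex hull (set L) \<inter> cball 0 r"] cc by simp
  qed
  have mT: "measure lebesgue ?T = (\<Sum>M\<in>?FM. measure lebesgue (convex hull (set M)))"
    using measure_flag_simplices_Union[OF centroid_extreme_points_mem T dT, of "\<lambda>M. convex hull (set M)"]
    by (simp add: coverM finite_imp_compact_convex_hull)
  \<comment> \<open>Each piece uses only the ball around the last vertex of its flag. An inequality
    is enough here, so it does not matter whether other balls reach into the piece.\<close>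
  have mTr: "(\<Sum>M\<in>?FM. measure lebesgue (convex hull (set M) \<inter> cball (M ! ?d) r))
      \<le> measure lebesgue (?T \<inter> (\<Union>u\<in>S. cball u r))"
  proof -
    have "(\<Sum>M\<in>?FM. measure lebesgue (convex hull (set M) \<inter> cball (M ! ?d) r))
      = measure lebesgue (\<Union>M\<in>?FM. convex hull (set M) \<inter> cball (M ! ?d) r)"
      by (simp add: measure_flag_simplices_Union[OF centroid_extreme_points_mem T dT] cc)
    also have "\<dots> \<le> measure lebesgue (?T \<inter> (\<Union>u\<in>S. cball u r))"
    proof (rule measure_mono_fmeasurable)
      show "(\<Union>M\<in>?FM. convex hull (set M) \<inter> cball (M ! ?d) r) \<subseteq> ?T \<inter> (\<Union>u\<in>S. cball u r)"
        using coverM barycentric_flag_inner(1)[OF S dist] by blast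
      show "(\<Union>M\<in>?FM. convex hull (set M) \<inter> cball (M ! ?d) r) \<in> sets lebesgue"
        using finite_flag_simplices[OF T] cc
        by (intro fmeasurableD lmeasurable_compact compact_UN) auto
      have "compact (\<Union>u\<in>S. cball u r)" using fS by (intro compact_UN) auto
      then show "?T \<inter> (\<Union>u\<in>S. cball u r) \<in> lmeasurable"
        using fS by (intro lmeasurable_compact compact_Int finite_imp_compact_convex_hull)
    qed
    finally show ?thesis .
  qed
  have "measure lebesgue (?C \<inter> cball 0 r) * measure lebesgue ?T =
    (\<Sum>L\<in>?FL. \<Sum>M\<in>?FM. measure lebesgue (convex hull (set L) \<inter> cball 0 r) * measure lebesgue (convex hull (set M)))"
    unfolding mCr mT by (rule sum_product)
  also have "\<dots> \<le> (\<Sum>L\<in>?FL. \<Sum>M\<in>?FM. measure lebesgue (convex hull (set L)) *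
      measure lebesgue (convex hull (set M) \<inter> cball (M ! ?d) r))"
    by (intro sum_mono flag_simplex_density_le[OF Y sep S dist])
  also have "\<dots> = measure lebesgue ?C * (\<Sum>M\<in>?FM. measure lebesgue (convex hull (set M) \<inter> cball (M ! ?d) r))"
    unfolding mC by (rule sum_product[symmetric])
  also have "\<dots> \<le> measure lebesgue ?C * measure lebesgue (?T \<inter> (\<Union>u\<in>S. cball u r))"
    by (intro mult_left_mono mTr) simp
  finally show ?thesis .
qed

subsection \<open>Packings\<close>

definition packing_cell :: "'a::euclidean_space set \<Rightarrow> 'a \<Rightarrow> 'a set" where
  "packing_cell X x = (+) x ` truncated_cell ((\<lambda>y. y - x) ` (X - {x}))"

lemma mem_packing_cell:
  assumes "x \<in> X"
  shows "z \<in> packing_cell X x \<longleftrightarrow> (\<forall>y\<in>X. dist z x \<le> dist z y) \<and> (\<forall>b\<in>Basis. \<bar>b \<bullet> (z - x)\<bar> \<le> 2)"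
proof -
  have d: "2 * ((y - x) \<bullet> (z - x)) \<le> (y - x) \<bullet> (y - x) \<longleftrightarrow> dist z x \<le> dist z y" for y
  proof -
    have "(z - y) \<bullet> (z - y) = ((z - x) - (y - x)) \<bullet> ((z - x) - (y - x))" by simp
    also have "\<dots> = (z - x) \<bullet> (z - x) + (y - x) \<bullet> (y - x) - 2 * ((y - x) \<bullet> (z - x))"
      by (simp only: inner_diff_left inner_diff_right inner_commute) simp
    finally show ?thesis by (simp add: dist_norm norm_le)
  qed
  have "z \<in> packing_cell X x \<longleftrightarrow> z - x \<in> truncated_cell ((\<lambda>y. y - x) ` (X - {x}))"
    by (force simp: packing_cell_def image_iff)
  also have "\<dots> \<longleftrightarrow> (\<forall>y\<in>X - {x}. dist z x \<le> dist z y) \<and> (\<forall>b\<in>Basis. \<bar>b \<bullet> (z - x)\<bar> \<le> 2)"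
    by (simp add: mem_truncated_cell d)
  finally show ?thesis by auto
qed

lemma packing_cell_density_le:
  fixes X S :: "'a::euclidean_space set"
  assumes X: "finite X" and sep: "pairwise (\<lambda>x y. 2 \<le> dist x y) X" and x: "x \<in> X"
    and S: "\<not> affine_dependent S" "card S = Suc DIM('a)"
    and dist: "\<And>x y. x \<in> S \<Longrightarrow> y \<in> S \<Longrightarrow> x \<noteq> y \<Longrightarrow> dist x y = 2"
  shows "measure lebesgue (packing_cell X x \<inter> cball x r) * measure lebesgue (convex hull S)
    \<le> measure lebesgue (packing_cell X x) * measure lebesgue (convex hull S \<inter> (\<Union>u\<in>S. cball u r))"
proof -
  let ?Y = "(\<lambda>y. y - x) ` (X - {x})"
  have "insert 0 ?Y = (\<lambda>y. y - x) ` X" using x by auto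
  moreover have "pairwise (\<lambda>x y. 2 \<le> dist x y) ((\<lambda>y. y - x) ` X)"
    using sep by (auto simp: pairwise_def dist_norm)
  ultimately have "pairwise (\<lambda>x y. 2 \<le> dist x y) (insert 0 ?Y)" by simp
  moreover have "0 \<notin> ?Y" "finite ?Y" using X by auto
  ultimately have "measure lebesgue (truncated_cell ?Y \<inter> cball 0 r) * measure lebesgue (convex hull S)
    \<le> measure lebesgue (truncated_cell ?Y) * measure lebesgue (convex hull S \<inter> (\<Union>u\<in>S. cball u r))"
    by (intro truncated_cell_density_le[OF _ _ _ S dist])
  moreover have "packing_cell X x \<inter> cball x r = (+) x ` (truncated_cell ?Y \<inter> cball 0 r)"
    by (auto simp: packing_cell_def dist_norm)
  ultimately show ?thesis by (simp add: measure_translation) (simp add: packing_cell_def measure_translation)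
qed

lemma compact_packing_cell: "finite X \<Longrightarrow> compact (packing_cell X x)"
  unfolding packing_cell_def by (rule compact_translation) (simp add: polytope_imp_compact polytope_truncated_cell)

text \<open>A covered point is within \<open>r\<close> of its nearest centre. The bound
  \<open>r \<le> 2\<close> keeps it inside the cube around that centre, so truncating the Voronoi
  cells loses no covered volume. The cells overlap only in null sets and stay near their
  centres.\<close>

lemma finite_packing_volume_le:
  fixes X S :: "'a::euclidean_space set"
  assumes X: "finite X" and sep: "pairwise (\<lambda>x y. 2 \<le> dist x y) X" and r: "r \<le> 2"
    and S: "\<not> affine_dependent S" "card S = Suc DIM('a)"
    and dist: "\<And>x y. x \<in> S \<Longrightarrow> y \<in> S \<Longrightarrow> x \<noteq> y \<Longrightarrow> dist x y = 2"
  shows "measure lebesgue (\<Union>x\<in>X. cball x r) * measure lebesgue (convex hull S)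
    \<le> measure lebesgue (\<Union>x\<in>X. cball x (2 * real DIM('a))) *
      measure lebesgue (convex hull S \<inter> (\<Union>u\<in>S. cball u r))"
proof -
  have cpt: "compact (packing_cell X x)" "compact (packing_cell X x \<inter> cball x r)" for x
    using compact_packing_cell[OF X] by (auto intro: compact_Int_closed)
  have cover: "(\<Union>x\<in>X. cball x r) \<subseteq> (\<Union>x\<in>X. packing_cell X x \<inter> cball x r)"
  proof
    fix z assume "z \<in> (\<Union>x\<in>X. cball x r)"
    then obtain y where y: "y \<in> X" "dist z y \<le> r" by (auto simp: dist_commute)
    obtain x where x: "x \<in> X" "\<And>w. w \<in> X \<Longrightarrow> dist z x \<le> dist z w"
      using ex_is_arg_min_if_finite[OF X, of "dist z"] y(1) by (force simp: is_arg_min_linorder)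
    have zx: "dist z x \<le> r" using x(2)[OF y(1)] y(2) by simp
    have "\<bar>b \<bullet> (z - x)\<bar> \<le> 2" if "b \<in> Basis" for b
      using Basis_le_norm[OF that, of "z - x"] zx r by (simp add: inner_commute dist_norm)
    then have "z \<in> packing_cell X x" using x mem_packing_cell by blast
    then show "z \<in> (\<Union>x\<in>X. packing_cell X x \<inter> cball x r)" using zx x(1) by (auto simp: dist_commute)
  qed
  \<comment> \<open>A common point is equidistant from both centres and lies on their bisecting
    hyperplane.\<close>
  have overlap: "negligible (packing_cell X x \<inter> packing_cell X y)" if "x \<in> X" "y \<in> X" "x \<noteq> y" for x y
  proof -
    have "packing_cell X x \<inter> packing_cell X y \<subseteq> {z. (2 *\<^sub>R (y - x)) \<bullet> z = y \<bullet> y - x \<bullet> x}"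
    proof
      fix z assume "z \<in> packing_cell X x \<inter> packing_cell X y"
      then have "dist z x = dist z y" using that by (auto simp: mem_packing_cell intro: antisym)
      then have "(z - x) \<bullet> (z - x) = (z - y) \<bullet> (z - y)" by (simp add: dist_norm norm_eq)
      then show "z \<in> {z. (2 *\<^sub>R (y - x)) \<bullet> z = y \<bullet> y - x \<bullet> x}"
        by (simp add: inner_diff_left inner_diff_right inner_commute)
    qed
    then show ?thesis using negligible_hyperplane[of "2 *\<^sub>R (y - x)"] negligible_subset that by auto
  qed
  have "measure lebesgue (\<Union>x\<in>X. cball x r) \<le> measure lebesgue (\<Union>x\<in>X. packing_cell X x \<inter> cball x r)"
    using X cpt by (intro measure_mono_fmeasurable[OF cover] fmeasurableD lmeasurable_compact compact_UN) auto
  also have "\<dots> \<le> (\<Sum>x\<in>X. measure lebesgue (packing_cell X x \<inter> cball x r))"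
    using X cpt by (intro measure_UNION_le) (auto intro: lmeasurable_compact fmeasurableD)
  finally have "measure lebesgue (\<Union>x\<in>X. cball x r) * measure lebesgue (convex hull S)
    \<le> (\<Sum>x\<in>X. measure lebesgue (packing_cell X x \<inter> cball x r)) * measure lebesgue (convex hull S)"
    by (rule mult_right_mono) simp
  also have "\<dots> = (\<Sum>x\<in>X. measure lebesgue (packing_cell X x \<inter> cball x r) * measure lebesgue (convex hull S))"
    by (simp add: sum_distrib_right)
  also have "\<dots> \<le> (\<Sum>x\<in>X. measure lebesgue (packing_cell X x) *
      measure lebesgue (convex hull S \<inter> (\<Union>u\<in>S. cball u r)))"
    by (intro sum_mono packing_cell_density_le[OF X sep _ S dist])
  also have "\<dots> = (\<Sum>x\<in>X. measure lebesgue (packing_cell X x)) *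
      measure lebesgue (convex hull S \<inter> (\<Union>u\<in>S. cball u r))"
    by (simp add: sum_distrib_right)
  also have "(\<Sum>x\<in>X. measure lebesgue (packing_cell X x)) = measure lebesgue (\<Union>x\<in>X. packing_cell X x)"
    using X cpt overlap
    by (intro measure_negligible_finite_Union_image[symmetric]) (auto simp: pairwise_def lmeasurable_compact)
  also have "\<dots> * measure lebesgue (convex hull S \<inter> (\<Union>u\<in>S. cball u r))
    \<le> measure lebesgue (\<Union>x\<in>X. cball x (2 * real DIM('a))) *
      measure lebesgue (convex hull S \<inter> (\<Union>u\<in>S. cball u r))"
  proof (intro mult_right_mono measure_mono_fmeasurable)
    have "packing_cell X x \<subseteq> cball x (2 * real DIM('a))" for x
      using truncated_cell_subset_cball by (fastforce simp: packing_cell_def dist_norm)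
    then show "(\<Union>x\<in>X. packing_cell X x) \<subseteq> (\<Union>x\<in>X. cball x (2 * real DIM('a)))" by blast
  qed (use X cpt in \<open>auto intro!: fmeasurableD lmeasurable_compact compact_UN\<close>)
  finally show ?thesis .
qed

section \<open>Volume bounds inside a large ball\<close>

lemma simplex_volume_pos:
  fixes S :: "'a::euclidean_space set"
  assumes "\<not> affine_dependent S" "card S = Suc DIM('a)"
  shows "0 < measure lebesgue (convex hull S)"
proof -
  have fin: "finite S" by (rule aff_independent_finite[OF assms(1)])
  have dim: "aff_dim (convex hull S) = int DIM('a)"
    using assms by (simp add: aff_dim_convex_hull affine_independent_iff_card)
  have "convex hull S \<noteq> {}" using assms(2) by auto
  then have "interior (convex hull S) \<noteq> {}"
    using rel_interior_eq_empty[OF convex_convex_hull[of S]] dim by (simp add: interior_rel_interior_gen)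
  then have "\<not> negligible (convex hull S)" by (simp add: negligible_convex_interior)
  moreover have "convex hull S \<in> lmeasurable"
    using fin by (intro lmeasurable_compact finite_imp_compact_convex_hull)
  ultimately show ?thesis
    using negligible_iff_measure by (simp add: zero_less_measure_iff negligible_iff_measure)
qed

lemma finite_separated_bounded:
  fixes X :: "'a::euclidean_space set"
  assumes "pairwise (\<lambda>x y. 2 \<le> dist x y) X" "bounded X"
  shows "finite X"
proof -
  have "uniform_discrete X"
    unfolding uniform_discrete_def using assms(1) by (intro exI[of _ 2]) (force simp: pairwise_def)
  then show ?thesis using assms(2) uniform_discrete_finite_iff by blast
qed

text \<open>Only the finitely many centres within \<open>1 + lam\<close> of the ball of radius
  \<open>R\<close> contribute, and their truncated cells reach at most \<open>2 * DIM('a)\<close>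
  further.\<close>

lemma soft_packing_measure_le:
  fixes c :: "nat \<Rightarrow> 'a::euclidean_space" and S :: "'a set"
  assumes c: "unit_ball_packing c" and lam: "lam \<le> 1"
    and S: "\<not> affine_dependent S" "card S = Suc DIM('a)"
    and dist: "\<And>x y. x \<in> S \<Longrightarrow> y \<in> S \<Longrightarrow> x \<noteq> y \<Longrightarrow> dist x y = 2"
  shows "measure lebesgue (soft_packing c lam \<inter> cball 0 R) * measure lebesgue (convex hull S)
    \<le> measure lebesgue (cball (0::'a) (R + (1 + lam) + 2 * real DIM('a))) *
      measure lebesgue (convex hull S \<inter> (\<Union>u\<in>S. cball u (1 + lam)))"
proof -
  let ?r = "1 + lam" and ?d = "2 * real DIM('a)"
  define X where "X = {x \<in> range c. norm x \<le> R + ?r}"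
  have sep: "pairwise (\<lambda>x y. 2 \<le> dist x y) X"
  proof -
    have "2 \<le> dist (c i) (c j)" if "i \<noteq> j" for i j
      using c that unfolding unit_ball_packing_def dist_norm by (metis linorder_neqE_nat norm_minus_commute)
    then show ?thesis unfolding X_def pairwise_def by (metis (no_types, lifting) imageE mem_Collect_eq)
  qed
  have "bounded X" unfolding bounded_iff by (auto simp: X_def)
  then have X: "finite X" by (rule finite_separated_bounded[OF sep])
  have sub: "soft_packing c lam \<inter> cball 0 R = (\<Union>x\<in>X. cball x ?r) \<inter> cball 0 R"
  proof -
    have "norm x \<le> R + ?r" if "dist x z \<le> ?r" "norm z \<le> R" for x z :: 'a
      using that norm_triangle_sub[of x z] by (simp add: dist_norm)
    then show ?thesis by (fastforce simp: soft_packing_def X_def)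
  qed
  have cX: "compact (\<Union>x\<in>X. cball x s)" for s using X by (intro compact_UN) auto
  have "measure lebesgue (soft_packing c lam \<inter> cball 0 R) \<le> measure lebesgue (\<Union>x\<in>X. cball x ?r)"
    unfolding sub using cX
    by (intro measure_mono_fmeasurable) (auto intro!: fmeasurableD lmeasurable_compact compact_Int_closed)
  then have "measure lebesgue (soft_packing c lam \<inter> cball 0 R) * measure lebesgue (convex hull S)
    \<le> measure lebesgue (\<Union>x\<in>X. cball x ?r) * measure lebesgue (convex hull S)"
    by (rule mult_right_mono) simp
  also have "\<dots> \<le> measure lebesgue (\<Union>x\<in>X. cball x ?d) *
      measure lebesgue (convex hull S \<inter> (\<Union>u\<in>S. cball u ?r))"
    by (rule finite_packing_volume_le[OF X sep _ S dist]) (use lam in auto)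
  also have "\<dots> \<le> measure lebesgue (cball (0::'a) (R + ?r + ?d)) *
      measure lebesgue (convex hull S \<inter> (\<Union>u\<in>S. cball u ?r))"
  proof (intro mult_right_mono measure_mono_fmeasurable)
    have "norm z \<le> R + ?r + ?d" if "norm x \<le> R + ?r" "dist x z \<le> ?d" for x z :: 'a
      using that norm_triangle_sub[of z x] by (simp add: dist_norm norm_minus_commute)
    then show "(\<Union>x\<in>X. cball x ?d) \<subseteq> cball 0 (R + ?r + ?d)" by (fastforce simp: X_def)
  qed (use cX in \<open>auto intro!: fmeasurableD lmeasurable_compact\<close>)
  finally show ?thesis .
qed

section \<open>Passage to the limit and strictness\<close>

lemma measure_cball_ratio_tendsto:
  "((\<lambda>R. measure lebesgue (cball (0::'a::euclidean_space) (R + K)) / measure lebesgue (cball (0::'a) R)) \<longlongrightarrow> 1) at_top"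
proof -
  have "((\<lambda>R. 1 + K / R) \<longlongrightarrow> 1 + 0) at_top"
    by (intro tendsto_intros tendsto_divide_0[OF tendsto_const] filterlim_at_top_imp_at_infinity filterlim_ident)
  then have "((\<lambda>R. (1 + K / R) ^ DIM('a)) \<longlongrightarrow> 1 ^ DIM('a)) at_top" by (intro tendsto_power) simp
  moreover have "eventually (\<lambda>R. (1 + K / R) ^ DIM('a) =
      measure lebesgue (cball (0::'a) (R + K)) / measure lebesgue (cball (0::'a) R)) at_top"
    \<comment> \<open>Beyond this threshold both radii are positive and the volume formula for balls
      applies.\<close>
    using eventually_gt_at_top[of "max 0 (- K)"]
  proof eventually_elim
    case (elim R)
    have "unit_ball_vol (real DIM('a)) \<noteq> 0" 
      by (rule less_imp_neq[THEN not_sym], rule unit_ball_vol_pos) simp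
    then show ?case
      using elim by (simp add: content_cball power_divide[symmetric] add_divide_distrib)
  qed
  ultimately show ?thesis by (simp add: tendsto_cong)
qed

text \<open>The density in the ball of radius \<open>R\<close> is at most \<open>s\<close> times a
  volume ratio of two concentric balls whose radii differ by the constant \<open>K\<close>, and this
  ratio tends to 1.\<close>

lemma upper_density_soft_packing_le:
  fixes c :: "nat \<Rightarrow> 'a::euclidean_space" and S :: "'a set"
  assumes c: "unit_ball_packing c" and lam: "lam \<le> 1"
    and S: "\<not> affine_dependent S" "card S = Suc DIM('a)"
    and dist: "\<And>x y. x \<in> S \<Longrightarrow> y \<in> S \<Longrightarrow> x \<noteq> y \<Longrightarrow> dist x y = 2"
  shows "upper_density (soft_packing c lam) \<le>
    ereal (measure lebesgue (convex hull S \<inter> (\<Union>u\<in>S. cball u (1 + lam))) / measure lebesgue (convex hull S))"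
proof -
  define K where "K = (1 + lam) + 2 * real DIM('a)"
  define s where "s = measure lebesgue (convex hull S \<inter> (\<Union>u\<in>S. cball u (1 + lam))) / measure lebesgue (convex hull S)"
  define q where "q R = measure lebesgue (cball (0::'a) (R + K)) / measure lebesgue (cball (0::'a) R)" for R
  have "measure lebesgue (soft_packing c lam \<inter> cball 0 R) / measure lebesgue (cball (0::'a) R) \<le> s * q R" for R
  proof -
    have "measure lebesgue (soft_packing c lam \<inter> cball 0 R) \<le> measure lebesgue (cball (0::'a) (R + K)) * s"
      using soft_packing_measure_le[OF c lam S dist, of R] simplex_volume_pos[OF S]
      by (simp add: s_def K_def add.assoc pos_le_divide_eq)
    then have "measure lebesgue (soft_packing c lam \<inter> cball 0 R) / measure lebesgue (cball (0::'a) R)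
        \<le> measure lebesgue (cball (0::'a) (R + K)) * s / measure lebesgue (cball (0::'a) R)"
      by (rule divide_right_mono) simp
    then show ?thesis by (simp add: q_def mult.commute)
  qed
  then have "upper_density (soft_packing c lam) \<le> Limsup at_top (\<lambda>R. ereal (s * q R))"
    unfolding upper_density_def by (intro Limsup_mono) simp
  also have "((\<lambda>R. s * q R) \<longlongrightarrow> s * 1) at_top"
    unfolding q_def by (intro tendsto_mult measure_cball_ratio_tendsto tendsto_const)
  then have "Limsup at_top (\<lambda>R. ereal (s * q R)) = ereal s"
    by (intro lim_imp_Limsup) auto
  finally show ?thesis by (simp add: s_def)
qed

text \<open>The centroid is an interior point whose distance to every vertex is the circumradius. As
  \<open>r\<close> is smaller, a whole ball around the centroid inside the simplex stays
  uncovered.\<close>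

lemma simplex_soft_density_less_1:
  fixes S :: "'a::euclidean_space set"
  assumes S: "\<not> affine_dependent S" "card S = Suc DIM('a)"
    and dist: "\<And>x y. x \<in> S \<Longrightarrow> y \<in> S \<Longrightarrow> x \<noteq> y \<Longrightarrow> dist x y = 2"
    and r: "r < sqrt (2 * real DIM('a) / (real DIM('a) + 1))"
  shows "measure lebesgue (convex hull S \<inter> (\<Union>u\<in>S. cball u r)) < measure lebesgue (convex hull S)"
proof -
  let ?T = "convex hull S" and ?B = "\<Union>u\<in>S. cball u r"
  define g where "g = centroid S"
  have fin: "finite S" by (rule aff_independent_finite[OF S(1)])
  have "g \<in> rel_interior ?T"
    unfolding rel_interior_convex_hull_explicit[OF S(1)] g_def centroid_def
    using S(2) by (intro CollectI exI[of _ "\<lambda>_. 1 / real (card S)"]) (simp add: scaleR_sum_right)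
  moreover have "aff_dim ?T = int DIM('a)"
    using S by (simp add: aff_dim_convex_hull affine_independent_iff_card)
  ultimately have "g \<in> interior ?T" by (simp add: interior_rel_interior_gen)
  then obtain e where e: "e > 0" "ball g e \<subseteq> ?T" by (meson mem_interior)
  define m where "m = min e (sqrt (2 * real DIM('a) / (real DIM('a) + 1)) - r)"
  have m: "m > 0" using e r by (simp add: m_def)
  \<comment> \<open>Take both sets in \<open>centroid_inner\<close> to be \<open>S\<close>, which
    has \<open>DIM('a) + 1\<close> points.\<close>
  have gu: "dist g u = sqrt (2 * real DIM('a) / (real DIM('a) + 1))" if "u \<in> S" for u
    using centroid_inner[OF fin order_refl that dist] S(2)
    by (simp add: g_def dist_norm norm_eq_sqrt_inner add.commute)
  have disj: "ball g m \<inter> (?T \<inter> ?B) = {}"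
  proof -
    have "\<not> dist u z \<le> r" if "u \<in> S" "dist g z < m" for u z
      using gu[OF that(1)] that(2) dist_triangle[of g u z] by (simp add: m_def dist_commute)
    then show ?thesis by fastforce
  qed
  have "compact ?B" using fin by (intro compact_UN) auto
  then have meas: "?T \<inter> ?B \<in> lmeasurable" "?T \<in> lmeasurable"
    using fin by (auto intro!: lmeasurable_compact compact_Int finite_imp_compact_convex_hull)
  have "measure lebesgue (ball g m) + measure lebesgue (?T \<inter> ?B) = measure lebesgue (ball g m \<union> (?T \<inter> ?B))"
  proof -
    have "(?T \<inter> ?B) - ball g m = ?T \<inter> ?B" using disj by blast
    then show ?thesis using measure_Un2[OF lmeasurable_ball meas(1), of g m] by simp
  qed
  also have "\<dots> \<le> measure lebesgue ?T"
    using meas e by (intro measure_mono_fmeasurable) (auto simp: m_def)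
  finally have "measure lebesgue (ball g m) + measure lebesgue (?T \<inter> ?B) \<le> measure lebesgue ?T" .
  moreover have "0 < measure lebesgue (ball g m)" using content_ball_pos[OF m, of g] by simp
  ultimately show ?thesis by linarith
qed

theorem theorem5:
  fixes t :: "nat \<Rightarrow> 'a::euclidean_space" and lam :: real
  assumes "DIM('a) \<ge> 2"
    and "regular_simplex_vertices 2 t"
    and "0 \<le> lam"
    and "lam < sqrt (2 * real DIM('a) / (real DIM('a) + 1)) - 1"
  shows "max_soft_density TYPE('a) lam \<le> ereal (simplex_soft_density t lam)
    \<and> simplex_soft_density t lam < 1"
proof -
  define S where "S = t ` {..DIM('a)}"
  have ind: "\<not> affine_dependent S"
    using assms(2) by (simp add: regular_simplex_vertices_def S_def)
  have d2: "dist (t i) (t j) = 2" if "i \<le> DIM('a)" "j \<le> DIM('a)" "i \<noteq> j" for i j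
    using assms(2) that by (simp add: regular_simplex_vertices_def)
  have "inj_on t {..DIM('a)}"
    using d2 by (intro inj_onI) (metis atMost_iff dist_self zero_neq_numeral)
  then have card: "card S = Suc DIM('a)" by (simp add: S_def card_image)
  have dist: "dist x y = 2" if "x \<in> S" "y \<in> S" "x \<noteq> y" for x y
    using that d2 by (auto simp: S_def)
  \<comment> \<open>The circumradius is at most 2, hence \<open>lam \<le> 1\<close>: the enlarged
    balls fit into the cubes that truncate the cells.\<close>
  have "2 * real DIM('a) / (real DIM('a) + 1) \<le> 2\<^sup>2" by (simp add: field_simps)
  then have "sqrt (2 * real DIM('a) / (real DIM('a) + 1)) \<le> 2" by (simp add: real_le_lsqrt)
  then have lam: "lam \<le> 1" using assms(4) by simp
  have eq: "simplex_soft_density t lam =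
      measure lebesgue (convex hull S \<inter> (\<Union>u\<in>S. cball u (1 + lam))) / measure lebesgue (convex hull S)"
    by (simp add: simplex_soft_density_def S_def image_image)
  have "max_soft_density TYPE('a) lam \<le> ereal (simplex_soft_density t lam)"
    unfolding max_soft_density_def eq
    by (rule SUP_least) (use upper_density_soft_packing_le[OF _ lam ind card dist] in simp)
  moreover have "simplex_soft_density t lam < 1"
    unfolding eq using simplex_soft_density_less_1[OF ind card dist, of "1 + lam"] assms(4)
      simplex_volume_pos[OF ind card] by simp
  ultimately show ?thesis by simp
qed

end
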